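(* For every integer $n\ge 1$ let $\mathcal{MA}(n)$ be the class of abelian groups generated by an $n$-state Mealy automaton over the binary alphabet $\{0,1\}$. Let $\mathcal{FA}(m)$ (for $m\ge 0$) be the class of free abelian groups of rank not greater than $m$, and let $\mathcal{EA}_2(n)$ be the class of elementary abelian 2-groups of rank not greater than $n$. Then for every $n\ge 1$ $$\mathcal{MA}(n)=\mathcal{FA}(n-1)\cup\mathcal{EA}_2(n).$$ In particular, up to isomorphism there are exactly $2n$ abelian groups generated by an $n$-state Mealy automaton over the binary alphabet.
   Context: All classes are closed under isomorphism. The trivial group is regarded as the free abelian group of rank $0$ and as the elementary abelian 2-group of rank $0$. The rank of an elementary abelian 2-group is the minimal number of its generators. Mealy automata. Let $X$ be a nonempty finite set (alphabet). A Mealy automaton over $X$ is a quadruple $A=(X,Q,\varphi,\psi)$, where $Q$ is a finite set (of states), $\varphi\colon Q\times X\to Q$ is the transition function and $\psi\colon Q\times X\to X$ is the output function. $A$ is an $n$-state automaton if $|Q|=n$. $A$ is invertible if for every $q\in Q$ the map $x\mapsto\psi(q,x)$ is a bijection of $X$. Group generated by a Mealy automaton. Let $X^*$ be the set of finite words over $X$ (including the empty word $\epsilon$), viewed as a rooted tree with root $\epsilon$ in which $w$ is adjacent to $wx$ for $w\in X^*$, $x\in X$. Each state $q\in Q$ defines a transformation $q\colon X^*\to X^*$ recursively by $q(\epsilon)=\epsilon$ and $q(xw)=\psi(q,x)\,q'(w)$, where $q'=\varphi(q,x)$, for $x\in X$, $w\in X^*$. If $A$ is invertible, each of these transformations is an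 automorphism of the rooted tree $X^*$, and the group generated by $A$ is the subgroup $G(A)$ of $Aut(X^* )$ generated by the transformations of all states $q\in Q$. An abstract group $G$ is generated by an $n$-state Mealy automaton over a $k$-letter alphabet if there is an invertible Mealy automaton $A$ with an $n$-element set of states over a $k$-letter alphabet such that $G\simeq G(A)$. The binary alphabet is $X=\{0,1\}$. *)

theory Defs
  imports "HOL-Algebra.Bij" "HOL-Algebra.Generated_Groups" "HOL-Algebra.Free_Abelian_Groups"
    "HOL-Library.Extended_Nat"
begin

section \<open>Mealy automata\<close>

record ('q, 'x) mealy =
  alphabet :: "'x set"
  states :: "'q set"
  trans_fun :: "'q \<Rightarrow> 'x \<Rightarrow> 'q"
  out_fun :: "'q \<Rightarrow> 'x \<Rightarrow> 'x"

definition mealy_automaton :: "('q, 'x) mealy \<Rightarrow> bool" where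
  "mealy_automaton A \<longleftrightarrow>
     finite (alphabet A) \<and> alphabet A \<noteq> {} \<and> finite (states A) \<and>
     (\<forall>q\<in>states A. \<forall>x\<in>alphabet A. trans_fun A q x \<in> states A \<and> out_fun A q x \<in> alphabet A)"

definition invertible_mealy :: "('q, 'x) mealy \<Rightarrow> bool" where
  "invertible_mealy A \<longleftrightarrow> (\<forall>q\<in>states A. bij_betw (out_fun A q) (alphabet A) (alphabet A))"

primrec state_map :: "('q, 'x) mealy \<Rightarrow> 'q \<Rightarrow> 'x list \<Rightarrow> 'x list" where
  "state_map A q [] = []"
| "state_map A q (x # w) = out_fun A q x # state_map A (trans_fun A q x) w"


section \<open>Automorphisms of the rooted tree of words\<close>

definition tree_adj :: "'x set \<Rightarrow> 'x list \<Rightarrow> 'x list \<Rightarrow> bool" where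
  "tree_adj X v w \<longleftrightarrow> v \<in> lists X \<and> w \<in> lists X \<and> (\<exists>x\<in>X. w = v @ [x] \<or> v = w @ [x])"

text \<open>As usual for \<^const>\<open>BijGroup\<close>, elements of the group are functions that are
  \<^const>\<open>undefined\<close> outside \<^term>\<open>lists X\<close>, so that equality in the group is
  equality of transformations of the set of words over \<^term>\<open>X\<close>.\<close>

definition tree_automorphisms :: "'x set \<Rightarrow> ('x list \<Rightarrow> 'x list) set" where
  "tree_automorphisms X =
     {f \<in> Bij (lists X). f [] = [] \<and>
        (\<forall>v\<in>lists X. \<forall>w\<in>lists X. tree_adj X (f v) (f w) \<longleftrightarrow> tree_adj X v w)}"

definition tree_aut_group :: "'x set \<Rightarrow> ('x list \<Rightarrow> 'x list) monoid" where
  "tree_aut_group X = (BijGroup (lists X))\<lparr>carrier := tree_automorphisms X\<rparr>"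

definition mealy_group :: "('q, 'x) mealy \<Rightarrow> ('x list \<Rightarrow> 'x list) monoid" where
  "mealy_group A =
     (tree_aut_group (alphabet A))
       \<lparr>carrier := generate (tree_aut_group (alphabet A))
                    ((\<lambda>q. restrict (state_map A q) (lists (alphabet A))) ` states A)\<rparr>"

lemma subgroup_tree_automorphisms: "subgroup (tree_automorphisms X) (BijGroup (lists X))"
proof -
  interpret group "BijGroup (lists X)" by (rule group_BijGroup)
  show ?thesis
  proof (rule subgroupI)
    show "tree_automorphisms X \<subseteq> carrier (BijGroup (lists X))"
      by (auto simp: tree_automorphisms_def BijGroup_def)
    have "(\<lambda>w\<in>lists X. w) \<in> tree_automorphisms X"
      by (auto simp: tree_automorphisms_def id_Bij)
    then show "tree_automorphisms X \<noteq> {}" by blast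
  next
    fix f assume f: "f \<in> tree_automorphisms X"
    then have fB: "f \<in> Bij (lists X)" by (simp add: tree_automorphisms_def)
    then have bij: "bij_betw f (lists X) (lists X)" by (simp add: Bij_def)
    let ?g = "inv_into (lists X) f"
    have g: "?g w \<in> lists X" "f (?g w) = w" if "w \<in> lists X" for w
      using that bij_betw_imp_surj_on[OF bij] inv_into_into[of w f "lists X"]
        f_inv_into_f[of w f "lists X"]
      by simp_all
    have "?g [] = []"
      using f bij inv_into_f_f[of f "lists X" "[]"]
      by (auto simp: tree_automorphisms_def bij_betw_def)
    moreover have "tree_adj X (?g v) (?g w) \<longleftrightarrow> tree_adj X v w"
      if "v \<in> lists X" "w \<in> lists X" for v w
    proof -
      have "tree_adj X (f (?g v)) (f (?g w)) \<longleftrightarrow> tree_adj X (?g v) (?g w)"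
        using f g(1)[OF that(1)] g(1)[OF that(2)] by (simp add: tree_automorphisms_def)
      then show ?thesis by (simp only: g(2)[OF that(1)] g(2)[OF that(2)])
    qed
    ultimately show "inv\<^bsub>BijGroup (lists X)\<^esub> f \<in> tree_automorphisms X"
      unfolding inv_BijGroup[OF fB]
      by (auto simp: tree_automorphisms_def restrict_inv_into_Bij[OF fB])
  next
    fix f g assume fg: "f \<in> tree_automorphisms X" "g \<in> tree_automorphisms X"
    then have B: "f \<in> Bij (lists X)" "g \<in> Bij (lists X)"
      by (auto simp: tree_automorphisms_def)
    have "g w \<in> lists X" if "w \<in> lists X" for w
      using that Bij_imp_funcset[OF B(2)] by blast
    then show "f \<otimes>\<^bsub>BijGroup (lists X)\<^esub> g \<in> tree_automorphisms X"
      using fg B by (auto simp: tree_automorphisms_def BijGroup_def compose_Bij compose_eq)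
  qed
qed

lemma group_tree_aut_group: "group (tree_aut_group X)"
  unfolding tree_aut_group_def
  by (rule subgroup.subgroup_is_group[OF subgroup_tree_automorphisms group_BijGroup])

lemma state_map_in_lists:
  assumes "mealy_automaton A" "q \<in> states A" "w \<in> lists (alphabet A)"
  shows "state_map A q w \<in> lists (alphabet A)"
  using assms(3,2)
  by (induction w arbitrary: q) (use assms(1) in \<open>auto simp: mealy_automaton_def\<close>)

lemma length_state_map [simp]: "length (state_map A q w) = length w"
  by (induction w arbitrary: q) auto

lemma butlast_state_map: "butlast (state_map A q w) = state_map A q (butlast w)"
proof (induction w arbitrary: q)
  case (Cons x w)
  then show ?case by (cases w) auto
qed simp

lemma bij_betw_state_map:
  assumes A: "mealy_automaton A" "invertible_mealy A" and "q \<in> states A"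
  shows "bij_betw (state_map A q) (lists (alphabet A)) (lists (alphabet A))"
proof -
  let ?X = "alphabet A"
  have inj: "v = w"
    if "v \<in> lists ?X" "w \<in> lists ?X" "state_map A q v = state_map A q w" "q \<in> states A" for v w q
    using that
  proof (induction v arbitrary: w q)
    case Nil
    then show ?case by (cases w) auto
  next
    case (Cons x v)
    then obtain y u where w: "w = y # u" by (cases w) auto
    from Cons.prems have "inj_on (out_fun A q) ?X"
      using A(2) by (simp add: invertible_mealy_def bij_betw_def)
    from w Cons.prems have "out_fun A q x = out_fun A q y" "x \<in> ?X" "y \<in> ?X"
      using Cons.hyps by auto
    then have "x = y"
      using \<open>inj_on (out_fun A q) ?X\<close> by (simp add: inj_on_def)
    moreover have "v = u"
    proof (rule Cons.IH)
      show "u \<in> lists ?X" using Cons.prems(1) w by simp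
      show "state_map A (trans_fun A q x) v = state_map A (trans_fun A q x) u"
        using Cons.prems(2) w \<open>x = y\<close> by simp
      show "trans_fun A q x \<in> states A"
        using Cons.hyps Cons.prems(3) A(1) by (simp add: mealy_automaton_def)
    qed
    ultimately show ?case using w by simp
  qed
  have surj: "w \<in> state_map A q ` lists ?X" if "w \<in> lists ?X" "q \<in> states A" for w q
    using that
  proof (induction w arbitrary: q)
    case Nil
    show ?case by (rule image_eqI[of _ _ "[]"]) simp_all
  next
    case (Cons y w)
    have "y \<in> out_fun A q ` ?X"
      using A(2) Cons.hyps Cons.prems by (simp add: invertible_mealy_def bij_betw_def)
    then obtain x where x: "x \<in> ?X" "out_fun A q x = y"
      by blast
    have "trans_fun A q x \<in> states A"
      using x(1) Cons.prems A(1) by (simp add: mealy_automaton_def)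
    then obtain v where "v \<in> lists ?X" "w = state_map A (trans_fun A q x) v"
      using Cons.IH by blast
    with x have "y # w = state_map A q (x # v)" "x # v \<in> lists ?X" by simp_all
    then show ?case by blast
  qed
  show ?thesis
  proof (rule bij_betw_imageI)
    show "inj_on (state_map A q) (lists ?X)"
      by (rule inj_onI) (rule inj[OF _ _ _ assms(3)])
    show "state_map A q ` lists ?X = lists ?X"
      using surj[OF _ assms(3)] state_map_in_lists[OF A(1) assms(3)] by blast
  qed
qed

lemma tree_adj_iff:
  assumes "v \<in> lists X" "w \<in> lists X"
  shows "tree_adj X v w \<longleftrightarrow> w \<noteq> [] \<and> butlast w = v \<or> v \<noteq> [] \<and> butlast v = w"
proof -
  have *: "(\<exists>x\<in>X. b = a @ [x]) \<longleftrightarrow> b \<noteq> [] \<and> butlast b = a" if "b \<in> lists X" for a b :: "'a list"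
    using that by (cases b rule: rev_cases) auto
  show ?thesis
    unfolding tree_adj_def bex_disj_distrib *[OF assms(1)] *[OF assms(2)] using assms by simp
qed

lemma restrict_state_map_in_tree_aut_group:
  assumes A: "mealy_automaton A" "invertible_mealy A" and q: "q \<in> states A"
  shows "restrict (state_map A q) (lists (alphabet A)) \<in> carrier (tree_aut_group (alphabet A))"
proof -
  let ?X = "alphabet A"
  note bij = bij_betw_state_map[OF A q]
  have nil: "state_map A q v = [] \<longleftrightarrow> v = []" for v
    by (metis length_0_conv length_state_map)
  have eq: "state_map A q v = state_map A q w \<longleftrightarrow> v = w"
    if "v \<in> lists ?X" "w \<in> lists ?X" for v w
    using bij that by (auto simp: bij_betw_def inj_on_def)
  have bl: "butlast v \<in> lists ?X" if "v \<in> lists ?X" for v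
    using that by (auto dest: in_set_butlastD)
  have "tree_adj ?X (state_map A q v) (state_map A q w) \<longleftrightarrow> tree_adj ?X v w"
    if "v \<in> lists ?X" "w \<in> lists ?X" for v w
    using that state_map_in_lists[OF A(1) q that(1)] state_map_in_lists[OF A(1) q that(2)]
    by (simp only: tree_adj_iff butlast_state_map nil eq bl)
  moreover have "restrict (state_map A q) (lists ?X) \<in> Bij (lists ?X)"
    using bij by (simp add: Bij_def)
  ultimately show ?thesis
    by (simp add: tree_aut_group_def tree_automorphisms_def)
qed


section \<open>Groups generated by automata\<close>

text \<open>Taking the states to be natural numbers loses no generality:
  see \<open>mealy_relabel_states\<close> below.\<close>

definition generated_by_mealy :: "nat \<Rightarrow> 'x set \<Rightarrow> ('a, 'b) monoid_scheme \<Rightarrow> bool" where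
  "generated_by_mealy n X G \<longleftrightarrow>
     (\<exists>A :: (nat, 'x) mealy. mealy_automaton A \<and> invertible_mealy A \<and>
        alphabet A = X \<and> card (states A) = n \<and> G \<cong> mealy_group A)"

lemma mealy_relabel_states:
  fixes A :: "('q, 'x) mealy"
  assumes A: "mealy_automaton A" "invertible_mealy A"
  shows "\<exists>B :: (nat, 'x) mealy. mealy_automaton B \<and> invertible_mealy B \<and>
           alphabet B = alphabet A \<and> card (states B) = card (states A) \<and>
           mealy_group B = mealy_group A"
proof -
  obtain f :: "'q \<Rightarrow> nat" and n where f: "bij_betw f (states A) {..<n}"
    using A(1) ex_bij_betw_finite_nat[of "states A"]
    by (auto simp: mealy_automaton_def atLeast0LessThan)
  define g where "g = inv_into (states A) f"
  have g: "bij_betw g {..<n} (states A)"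
    unfolding g_def by (rule bij_betw_inv_into[OF f])
  have gf: "g (f q) = q" if "q \<in> states A" for q
    using bij_betw_inv_into_left[OF f that] by (simp add: g_def)
  define B :: "(nat, 'x) mealy" where
    "B = \<lparr>alphabet = alphabet A, states = {..<n},
          trans_fun = (\<lambda>i x. f (trans_fun A (g i) x)), out_fun = (\<lambda>i. out_fun A (g i))\<rparr>"
  have gi: "g i \<in> states A" if "i < n" for i
    using g that by (auto simp: bij_betw_def)
  have fq: "f q < n" if "q \<in> states A" for q
    using f that by (auto simp: bij_betw_def)
  have B: "mealy_automaton B" "invertible_mealy B"
    using A gi fq by (auto simp: mealy_automaton_def invertible_mealy_def B_def)
  have sm: "state_map B i w = state_map A (g i) w" if "i < n" "w \<in> lists (alphabet A)" for i w
    using that(2,1)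
  proof (induction w arbitrary: i)
    case (Cons x w)
    then have "trans_fun A (g i) x \<in> states A"
      using A(1) gi by (auto simp: mealy_automaton_def)
    then show ?case using Cons fq gf by (simp add: B_def)
  qed simp
  have "(\<lambda>i. restrict (state_map B i) (lists (alphabet A))) ` {..<n}
      = (\<lambda>i. restrict (state_map A (g i)) (lists (alphabet A))) ` {..<n}"
    by (intro image_cong refl restrict_ext) (simp add: sm)
  also have "\<dots> = (\<lambda>q. restrict (state_map A q) (lists (alphabet A))) ` (g ` {..<n})"
    by (simp add: image_image)
  also have "g ` {..<n} = states A"
    using g by (simp add: bij_betw_def)
  finally have gens: "(\<lambda>i. restrict (state_map B i) (lists (alphabet A))) ` {..<n}
      = (\<lambda>q. restrict (state_map A q) (lists (alphabet A))) ` states A" .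
  have "alphabet B = alphabet A" "states B = {..<n}" by (simp_all add: B_def)
  then have "mealy_group B = mealy_group A"
    unfolding mealy_group_def by (simp only: gens)
  moreover have "card (states B) = card (states A)"
    using bij_betw_same_card[OF f] by (simp add: B_def)
  ultimately show ?thesis
    using B by (intro exI[of _ B]) (simp add: B_def)
qed


section \<open>The three classes of abelian groups\<close>

text \<open>A class of groups is rendered as the set of its members with elements in a given type
  (a free type variable).  The isomorphism \<^const>\<open>is_iso\<close> does not constrain the unit field of
  a structure, hence the explicit requirement that the structures be groups.\<close>

definition MA :: "nat \<Rightarrow> ('a, 'b) monoid_scheme set" where
  "MA n = {G. comm_group G \<and> generated_by_mealy n {0, 1 :: nat} G}"

definition FA :: "nat \<Rightarrow> ('a, 'b) monoid_scheme set" where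
  "FA m = {G. comm_group G \<and> (\<exists>r\<le>m. G \<cong> free_Abelian_group {..<r})}"

definition elementary_abelian_2_group :: "('a, 'b) monoid_scheme \<Rightarrow> bool" where
  "elementary_abelian_2_group G \<longleftrightarrow>
     comm_group G \<and> (\<forall>x\<in>carrier G. x \<otimes>\<^bsub>G\<^esub> x = \<one>\<^bsub>G\<^esub>)"

text \<open>Minimal number of generators; it is \<^term>\<open>\<infinity>\<close> (the infimum of the empty set) when the
  group is not finitely generated.\<close>

definition group_rank :: "('a, 'b) monoid_scheme \<Rightarrow> enat" where
  "group_rank G =
     (INF S \<in> {S. S \<subseteq> carrier G \<and> finite S \<and> generate G S = carrier G}. enat (card S))"

definition EA2 :: "nat \<Rightarrow> ('a, 'b) monoid_scheme set" where
  "EA2 n = {G. elementary_abelian_2_group G \<and> group_rank G \<le> enat n}"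

text \<open>Isomorphism classes of \<^term>\<open>C\<close> are the elements of
  \<^term>\<open>C // iso_rel C\<close>.  Counting them among the groups with elements in \<^typ>\<open>'a\<close> counts
  all isomorphism types of countable groups only if \<^typ>\<open>'a\<close> is infinite; a group generated
  by a Mealy automaton is countable.\<close>

definition iso_rel :: "('a, 'b) monoid_scheme set \<Rightarrow> ('a, 'b) monoid_scheme rel" where
  "iso_rel C = {(G, H). G \<in> C \<and> H \<in> C \<and> G \<cong> H}"

end

(* In an abelian group generated by a binary automaton, some element swapping the two letters
forces the two sections of every non-swapping element to coincide. If a swapping involution
exists, the squares are non-swapping and closed under sections, hence trivial; otherwise the
torsion is non-swapping and closed under sections, so the group is torsion-free. In the latter
case a stationary distribution of the random walk on the states, moving along either letter with
probability 1/2, gives a multiplicative relation between the states, so that n - 1 elements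
suffice to generate. Conversely, Z^r (with one additional trivial state) and (Z/2)^r act on words,
read as r interleaved sequences of digits, by 2-adic, respectively digitwise, addition. *)

theory Submission
  imports Defs
begin


section \<open>Integer combinations in abelian groups\<close>

text \<open>Non-swapping elements from a set closed under sections fix every word, letter by letter;
  triviality is always shown below by exhibiting such a set. The sections coincide because of
  commutativity: for a swapping a, compare the sections of ax and xa. Consequently both sections of
  a square xx equal the product of the two sections of x, and this product is what one step of the
  random walk computes on products of states. The walk yields only that the square of some product
  of states is trivial. On the realizing side the additional state of Z^r comes from the carry:
  adding 1 to the digit 0 produces none, so the section is the identity and has to be a state as
  well. In the count, the ranks 0 to n - 1 and 0 to n give 2n + 1 pairs, of which the two with rank
  0 describe the same trivial group.\<close>

lemma homogeneous_system_nonzero_solution: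
  fixes a :: "'e \<Rightarrow> 'j \<Rightarrow> int"
  assumes "finite E" "finite J" "card E < card J"
  shows "\<exists>c. (\<exists>j\<in>J. c j \<noteq> 0) \<and> (\<forall>e\<in>E. (\<Sum>j\<in>J. a e j * c j) = 0)"
  using assms
proof (induction "card E" arbitrary: E J a)
  case 0
  then have "E = {}" "J \<noteq> {}" by auto
  then show ?case by (intro exI[of _ "\<lambda>_. 1"]) auto
next
  case (Suc k)
  then obtain e where e: "e \<in> E" by fastforce
  let ?E = "E - {e}"
  have E: "k = card ?E" "finite ?E" using Suc e by auto
  show ?case
  proof (cases "\<forall>j\<in>J. a e j = 0")
    case True
    obtain c where "\<exists>j\<in>J. c j \<noteq> 0" "\<forall>e\<in>?E. (\<Sum>j\<in>J. a e j * c j) = 0"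
      using Suc.hyps(1)[OF E(1) E(2) Suc.prems(2), of a] Suc.prems E(1) Suc.hyps(2) by auto
    moreover have "(\<Sum>j\<in>J. a e j * c j) = 0" using True by simp
    ultimately show ?thesis by blast
  next
    case False
    then obtain i where i: "i \<in> J" "a e i \<noteq> 0" by blast
    let ?J = "J - {i}"
    have "card ?E < card ?J" 
      using Suc.prems(3) Suc.hyps(2) e i(1) by (simp add: card_Diff_singleton)
    \<comment> \<open>The unknown \<open>i\<close> is eliminated by means of equation
      \<open>e\<close>; cross-multiplication avoids division.\<close>
    from Suc.hyps(1)[OF E(1) E(2) _ this, of "\<lambda>d j. a e i * a d j - a d i * a e j"]
    obtain c where c: "\<exists>j\<in>?J. c j \<noteq> 0"
      "\<And>d. d \<in> ?E \<Longrightarrow> (\<Sum>j\<in>?J. (a e i * a d j - a d i * a e j) * c j) = 0"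
      using Suc.prems by auto
    \<comment> \<open>The value at \<open>i\<close> makes equation \<open>e\<close> hold; the other
      values are scaled by \<open>a e i\<close>, which is nonzero, so the solution stays
      nontrivial.\<close>
    define c' where "c' j = (if j = i then - (\<Sum>j\<in>?J. a e j * c j) else a e i * c j)" for j
    have sum: "(\<Sum>j\<in>J. a d j * c' j) =
      (\<Sum>j\<in>?J. (a e i * a d j - a d i * a e j) * c j)" for d
    proof -
      have "(\<Sum>j\<in>J. a d j * c' j) = a d i * c' i + (\<Sum>j\<in>?J. a d j * c' j)"
        by (rule sum.remove[OF Suc.prems(2) i(1)])
      also have "(\<Sum>j\<in>?J. a d j * c' j) = (\<Sum>j\<in>?J. a e i * a d j * c j)"
        by (rule sum.cong) (auto simp: c'_def)
      also have "a d i * c' i = - (\<Sum>j\<in>?J. a d i * a e j * c j)"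
        by (simp add: c'_def sum_distrib_left mult.assoc)
      finally show ?thesis by (simp add: left_diff_distrib sum_subtractf)
    qed
    have "(\<Sum>j\<in>J. a d j * c' j) = 0" if "d \<in> E" for d
      unfolding sum using c(2)[of d] that by (cases "d = e") auto
    moreover have "\<exists>j\<in>J. c' j \<noteq> 0" using c(1) i by (auto simp: c'_def)
    ultimately show ?thesis by blast
  qed
qed

definition int_comb :: "('a, 'b) monoid_scheme \<Rightarrow> 'i set \<Rightarrow> ('i \<Rightarrow> 'a) \<Rightarrow> ('i \<Rightarrow> int) \<Rightarrow> 'a" where
  "int_comb G I f c = finprod G (\<lambda>i. f i [^]\<^bsub>G\<^esub> c i) I"

text \<open>Families instead of sets of generators: a change of generators may make entries
  coincide, while the number of indices is what has to be controlled.\<close>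

definition spans :: "('a, 'b) monoid_scheme \<Rightarrow> 'i set \<Rightarrow> ('i \<Rightarrow> 'a) \<Rightarrow> bool" where
  "spans G I f \<longleftrightarrow> finite I \<and> f ` I \<subseteq> carrier G \<and> generate G (f ` I) = carrier G"

lemma spansD:
  assumes "spans G I f"
  shows "finite I" "f ` I \<subseteq> carrier G" "generate G (f ` I) = carrier G"
  using assms by (auto simp: spans_def)

context comm_group
begin

lemma int_comb_closed [simp]:
  assumes "f ` I \<subseteq> carrier G" shows "int_comb G I f c \<in> carrier G"
  using assms by (auto simp: int_comb_def intro!: finprod_closed)

lemma int_comb_cong:
  assumes "f ` I \<subseteq> carrier G" "\<And>i. i \<in> I \<Longrightarrow> f i = g i" "\<And>i. i \<in> I \<Longrightarrow> c i = d i"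
  shows "int_comb G I f c = int_comb G I g d"
  unfolding int_comb_def by (rule finprod_cong') (use assms in auto)

lemma int_comb_zero: "(\<And>i. i \<in> I \<Longrightarrow> c i = 0) \<Longrightarrow> int_comb G I f c = \<one>"
  by (auto simp: int_comb_def intro: finprod_one_eqI)

lemma int_comb_add:
  assumes "f ` I \<subseteq> carrier G"
  shows "int_comb G I f (\<lambda>i. c i + d i) = int_comb G I f c \<otimes> int_comb G I f d"
proof -
  have "int_comb G I f (\<lambda>i. c i + d i) = finprod G (\<lambda>i. f i [^] c i \<otimes> f i [^] d i) I"
    unfolding int_comb_def by (rule finprod_cong') (use assms in \<open>auto simp: int_pow_mult\<close>)
  also have "\<dots> = int_comb G I f c \<otimes> int_comb G I f d"
    unfolding int_comb_def by (rule finprod_multf) (use assms in auto)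
  finally show ?thesis .
qed

lemma int_comb_minus:
  assumes "f ` I \<subseteq> carrier G"
  shows "int_comb G I f (\<lambda>i. - c i) = inv (int_comb G I f c)"
proof -
  have "int_comb G I f (\<lambda>i. - c i) \<otimes> int_comb G I f c = \<one>"
    by (simp add: int_comb_add[OF assms, symmetric] int_comb_zero)
  then show ?thesis using assms by (simp add: inv_equality)
qed

lemma int_comb_diff_eq_one_iff:
  assumes "f ` I \<subseteq> carrier G"
  shows "int_comb G I f (\<lambda>i. c i - d i) = \<one> \<longleftrightarrow> int_comb G I f c = int_comb G I f d"
proof -
  have "int_comb G I f (\<lambda>i. c i - d i) = int_comb G I f c \<otimes> inv (int_comb G I f d)"
    using int_comb_add[OF assms, of c "\<lambda>i. - d i"] by (simp add: int_comb_minus[OF assms])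
  moreover have "x \<otimes> inv y = \<one> \<longleftrightarrow> x = y" if "x \<in> carrier G" "y \<in> carrier G" for x y
    using that inv_equality[of x "inv y"] by auto
  ultimately show ?thesis using assms by simp
qed

lemma int_comb_scale:
  assumes "f ` I \<subseteq> carrier G"
  shows "int_comb G I f (\<lambda>i. k * c i) = int_comb G I f c [^] (k::int)"
proof (induction k rule: int_induct[of _ 0])
  case base
  show ?case by (simp add: int_comb_zero)
next
  case (step1 i)
  then show ?case
    using assms by (simp add: distrib_right int_comb_add int_pow_mult)
next
  case (step2 i)
  have "int_comb G I f (\<lambda>j. (i - 1) * c j) = int_comb G I f (\<lambda>j. i * c j + - c j)"
    by (simp add: algebra_simps)
  also have "\<dots> = int_comb G I f c [^] i \<otimes> inv (int_comb G I f c)"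
    using step2 by (simp only: int_comb_add[OF assms] int_comb_minus[OF assms])
  also have "\<dots> = int_comb G I f c [^] (i - 1)"
    using int_pow_mult[of "int_comb G I f c" i "-1"] assms by (simp add: int_pow_neg)
  finally show ?case .
qed

lemma int_comb_remove:
  assumes "finite I" "i \<in> I" "f ` I \<subseteq> carrier G"
  shows "int_comb G I f c = f i [^] c i \<otimes> int_comb G (I - {i}) f c"
proof -
  have "int_comb G (insert i (I - {i})) f c = f i [^] c i \<otimes> int_comb G (I - {i}) f c"
    unfolding int_comb_def by (rule finprod_insert) (use assms in auto)
  then show ?thesis using assms(2) by (simp add: insert_absorb)
qed

lemma int_comb_unit:
  assumes "finite I" "i \<in> I" "f ` I \<subseteq> carrier G"
  shows "int_comb G I f (\<lambda>j. if j = i then k else 0) = f i [^] k"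
proof -
  have "int_comb G (I - {i}) f (\<lambda>j. if j = i then k else 0) = \<one>"
    by (rule int_comb_zero) auto
  then show ?thesis using assms by (simp add: int_comb_remove[OF assms] image_subset_iff)
qed

lemma generate_eq_range_int_comb:
  assumes "finite I" "f ` I \<subseteq> carrier G"
  shows "generate G (f ` I) = range (int_comb G I f)"
proof
  show "generate G (f ` I) \<subseteq> range (int_comb G I f)"
  proof
    fix x assume "x \<in> generate G (f ` I)"
    then show "x \<in> range (int_comb G I f)"
    proof induction
      case one
      show ?case using int_comb_zero[of I "\<lambda>_. 0" f] by (metis rangeI)
    next
      case (incl h)
      then obtain i where i: "i \<in> I" "h = f i" by blast
      then have "h = int_comb G I f (\<lambda>j. if j = i then 1 else 0)"
        using int_comb_unit[OF assms(1) i(1) assms(2), of 1] assms by (simp add: image_subset_iff)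
      then show ?case by simp
    next
      case (inv h)
      then obtain i where i: "i \<in> I" "h = f i" by blast
      then have "inv h = int_comb G I f (\<lambda>j. if j = i then - 1 else 0)"
        using int_comb_unit[OF assms(1) i(1) assms(2), of "-1"] assms
        by (simp add: image_subset_iff int_pow_neg)
      then show ?case by simp
    next
      case (eng h1 h2)
      then obtain c d where "h1 = int_comb G I f c" "h2 = int_comb G I f d" by blast
      then have "h1 \<otimes> h2 = int_comb G I f (\<lambda>i. c i + d i)"
        using assms by (simp add: int_comb_add)
      then show ?case by simp
    qed
  qed
next
  interpret S: subgroup "generate G (f ` I)" G
    by (rule generate_is_subgroup[OF assms(2)])
  have "int_comb G J f c \<in> generate G (f ` I)" if "finite J" "J \<subseteq> I" for J c
    using that
  proof (induction J)
    case empty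
    show ?case by (simp add: int_comb_def)
  next
    case (insert i J)
    have "int_comb G (insert i J) f c = f i [^] c i \<otimes> int_comb G J f c"
      unfolding int_comb_def by (rule finprod_insert) (use insert assms in auto)
    moreover have "f i \<in> generate G (f ` I)" using insert by (auto intro: generate.incl)
    ultimately show ?case
      using insert subgroup_int_pow_closed[OF generate_is_subgroup[OF assms(2)]] by auto
  qed
  then show "range (int_comb G I f) \<subseteq> generate G (f ` I)"
    using assms(1) by auto
qed

section \<open>Generating families and the removal of generators by relations\<close>

lemma spans_obtain:
  assumes "spans G I f" "x \<in> carrier G"
  obtains c where "x = int_comb G I f c"
  using assms generate_eq_range_int_comb[of I f] unfolding spans_def by blast

lemma spans_reindex:
  assumes "spans G I f"
  obtains g :: "nat \<Rightarrow> 'a" where "spans G {..<card I} g"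
proof -
  obtain h where h: "bij_betw h {..<card I} I"
    using assms by (metis spans_def ex_bij_betw_nat_finite atLeast0LessThan)
  then have "(f \<circ> h) ` {..<card I} = f ` I" by (metis bij_betw_def image_comp)
  then have "spans G {..<card I} (f \<circ> h)" using assms by (simp add: spans_def)
  then show ?thesis by (rule that)
qed

lemma spansI:
  assumes "finite I" "f ` I \<subseteq> carrier G" "carrier G \<subseteq> generate G (f ` I)"
  shows "spans G I f"
  using assms generate_incl[of "f ` I"] by (auto simp: spans_def)

lemma spans_change:
  assumes "spans G I f" "finite J" "g ` J \<subseteq> carrier G" "f ` I \<subseteq> generate G (g ` J)"
  shows "spans G J g"
  using assms generate_subgroup_incl[OF assms(4) generate_is_subgroup[OF assms(3)]]
  by (intro spansI) (auto simp: spans_def)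

lemma spans_drop:
  assumes "spans G I f" "i \<in> I" "f i \<in> generate G (f ` (I - {i}))"
  shows "spans G (I - {i}) f"
  by (rule spans_change[OF assms(1)])
    (use assms in \<open>auto simp: spans_def intro: generate.incl\<close>)

text \<open>The relation is solved for \<open>f i\<close>. The assumption
  \<open>f i [^] c i = f i\<close> plays the role of a coefficient 1; when all squares are trivial,
  every odd coefficient satisfies it.\<close>

lemma spans_drop_of_relation:
  assumes sp: "spans G I f" and i: "i \<in> I" and rel: "int_comb G I f c = \<one>"
    and ci: "f i [^] c i = f i"
  shows "spans G (I - {i}) f"
proof -
  note s = spansD[OF sp]
  have "f i \<otimes> int_comb G (I - {i}) f c = \<one>"
    using int_comb_remove[OF s(1) i s(2)] rel ci by simp
  then have "f i = inv (int_comb G (I - {i}) f c)"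
    by (intro inv_equality[symmetric]) (use s(2) i in \<open>auto intro!: int_comb_closed\<close>)
  also have "\<dots> = int_comb G (I - {i}) f (\<lambda>i. - c i)"
    by (rule int_comb_minus[symmetric]) (use s(2) in auto)
  finally have "f i \<in> generate G (f ` (I - {i}))"
    using generate_eq_range_int_comb[of "I - {i}" f] s by auto
  then show ?thesis by (rule spans_drop[OF sp i])
qed

text \<open>The old \<open>f j\<close> is recovered by the same change with
  \<open>- k\<close>.\<close>

lemma spans_transvection:
  assumes sp: "spans G I f" and ij: "i \<in> I" "j \<in> I" "i \<noteq> j"
  shows "spans G I (f(j := f j \<otimes> f i [^] (k::int)))"
proof (rule spans_change[OF sp])
  let ?g = "f(j := f j \<otimes> f i [^] k)"
  note s = spansD[OF sp]
  show "finite I" by fact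
  show g: "?g ` I \<subseteq> carrier G" using s ij by auto
  interpret S: subgroup "generate G (?g ` I)" G by (rule generate_is_subgroup[OF g])
  have mem: "f l \<in> generate G (?g ` I)" if "l \<in> I" "l \<noteq> j" for l
    using that by (intro generate.incl) (auto simp: image_iff intro!: bexI[of _ l])
  have "f j = (f j \<otimes> f i [^] k) \<otimes> f i [^] (- k)"
    using s(2) ij by (simp add: image_subset_iff m_assoc int_pow_mult[symmetric])
  moreover have "f j \<otimes> f i [^] k \<in> generate G (?g ` I)"
    using ij by (intro generate.incl) (auto simp: image_iff)
  moreover have "f i [^] (- k) \<in> generate G (?g ` I)"
    using mem[OF ij(1,3)] subgroup_int_pow_closed[OF generate_is_subgroup[OF g]] by blast
  ultimately have "f j \<in> generate G (?g ` I)" by (metis S.m_closed)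
  with mem show "f ` I \<subseteq> generate G (?g ` I)" by auto
qed

text \<open>A change of the generator \<open>j\<close> is compensated in the coefficient of
  \<open>i\<close>. Repeating this runs Euclid's algorithm on the coefficients of a
  relation.\<close>

lemma int_comb_transvection:
  assumes "finite I" "f ` I \<subseteq> carrier G" and ij: "i \<in> I" "j \<in> I" "i \<noteq> j"
  shows "int_comb G I (f(j := f j \<otimes> f i [^] (k::int))) (c(i := c i - k * c j)) = int_comb G I f c"
proof -
  let ?g = "f(j := f j \<otimes> f i [^] k)" and ?d = "c(i := c i - k * c j)"
  let ?J = "I - {j} - {i}"
  have cl: "f i \<in> carrier G" "f j \<in> carrier G" using assms by auto
  have split: "int_comb G I h e = h j [^] e j \<otimes> (h i [^] e i \<otimes> int_comb G ?J h e)"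
    if "h ` I \<subseteq> carrier G" for h and e :: "_ \<Rightarrow> int"
    using int_comb_remove[OF assms(1) ij(2) that, of e]
      int_comb_remove[of "I - {j}" i h e] assms that image_mono[of "I - {j}" I h] by auto
  have g: "?g ` I \<subseteq> carrier G" using assms cl by auto
  have rest: "int_comb G ?J ?g ?d = int_comb G ?J f c"
    by (rule int_comb_cong) (use g assms in auto)
  have R: "int_comb G ?J f c \<in> carrier G" using assms by (intro int_comb_closed) auto
  have pw: "(f j \<otimes> f i [^] k) [^] c j = f j [^] c j \<otimes> f i [^] (k * c j)"
    using cl by (simp add: int_pow_distrib int_pow_pow)
  have "f i [^] (k * c j) \<otimes> f i [^] (c i - k * c j) = f i [^] c i"
    using cl by (simp add: int_pow_mult[symmetric])
  then have "f j [^] c j \<otimes> f i [^] (k * c j) \<otimes> (f i [^] (c i - k * c j) \<otimes> int_comb G ?J f c)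
    = f j [^] c j \<otimes> (f i [^] c i \<otimes> int_comb G ?J f c)"
    using cl R by (simp add: m_assoc[symmetric]) (simp add: m_assoc)
  then show ?thesis
    using split[OF g, of ?d] split[OF assms(2), of c] ij rest pw by simp
qed

lemma spans_fewer_of_relation:
  assumes sp: "spans G I f" and rel: "int_comb G I f c = \<one>" and nz: "\<exists>i\<in>I. c i \<noteq> 0"
    and tf: "\<And>x k. x \<in> carrier G \<Longrightarrow> k \<noteq> 0 \<Longrightarrow> x [^] (k::int) = \<one> \<Longrightarrow> x = \<one>"
  shows "\<exists>i\<in>I. \<exists>g. spans G (I - {i}) g"
  using sp rel nz
proof (induction "nat (\<Sum>i\<in>I. \<bar>c i\<bar>)" arbitrary: f c rule: less_induct)
  case less
  note s = spansD[OF less.prems(1)]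
  show ?case
  proof (cases "\<exists>i\<in>I. \<exists>j\<in>I. i \<noteq> j \<and> c i \<noteq> 0 \<and> c j \<noteq> 0")
    case True
    then obtain i j where ij: "i \<in> I" "j \<in> I" "i \<noteq> j" "c i \<noteq> 0" "c j \<noteq> 0" "\<bar>c j\<bar> \<le> \<bar>c i\<bar>"
      by (metis linorder_le_cases)
    \<comment> \<open>With this sign, \<open>c i - k * c j\<close> has absolute value
      \<open>\<bar>c i\<bar> - \<bar>c j\<bar>\<close>.\<close>
    define k where "k = sgn (c i) * sgn (c j)"
    let ?d = "c(i := c i - k * c j)"
    have k: "\<bar>c i - k * c j\<bar> < \<bar>c i\<bar>" using ij by (auto simp: k_def sgn_if abs_if split: if_splits)
    have "(\<Sum>l\<in>I. \<bar>?d l\<bar>) = \<bar>?d i\<bar> + (\<Sum>l\<in>I - {i}. \<bar>?d l\<bar>)"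
      by (rule sum.remove) (use s ij in auto)
    also have "(\<Sum>l\<in>I - {i}. \<bar>?d l\<bar>) = (\<Sum>l\<in>I - {i}. \<bar>c l\<bar>)" by (rule sum.cong) auto
    also have "\<bar>?d i\<bar> + \<dots> < \<bar>c i\<bar> + \<dots>" using k by simp
    also have "\<dots> = (\<Sum>l\<in>I. \<bar>c l\<bar>)" by (rule sum.remove[symmetric]) (use s ij in auto)
    finally have "nat (\<Sum>l\<in>I. \<bar>?d l\<bar>) < nat (\<Sum>l\<in>I. \<bar>c l\<bar>)"
      using sum_nonneg[of I "\<lambda>l. \<bar>?d l\<bar>"] by (metis abs_ge_zero le_less_trans zless_nat_conj)
    moreover have "\<exists>l\<in>I. ?d l \<noteq> 0" using ij by (intro bexI[of _ j]) auto
    ultimately show ?thesis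
      using less.hyps spans_transvection[OF less.prems(1) ij(1-3), of k]
        int_comb_transvection[OF s(1,2) ij(1-3), of k c] less.prems(2) by metis
  next
    case False
    obtain i where i: "i \<in> I" "c i \<noteq> 0" using less.prems(3) by blast
    have "int_comb G (I - {i}) f c = \<one>" using False i by (intro int_comb_zero) auto
    then have "f i [^] c i = \<one>"
      using int_comb_remove[OF s(1) i(1) s(2), of c] less.prems(2) s(2) i(1)
      by (simp add: image_subset_iff)
    then have "f i = \<one>" using tf i s(2) by (meson image_subset_iff)
    then show ?thesis
      using spans_drop[OF less.prems(1) i(1)] i(1) generate.one by auto
  qed
qed

end

text \<open>One notion for both classes: \<open>m = 0\<close> means Z^r, as \<open>0 dvd c i\<close>
  says \<open>c i = 0\<close>, and \<open>m = 2\<close> means (Z/2)^r. Membership is expressed by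
  independent generators, so that neither \<open>free_Abelian_group\<close> nor
  \<open>group_rank\<close> enters the arguments about automata.\<close>

definition homocyclic :: "int \<Rightarrow> nat \<Rightarrow> ('a, 'b) monoid_scheme \<Rightarrow> bool" where
  "homocyclic m r G \<longleftrightarrow> comm_group G \<and>
     (\<exists>f. spans G {..<r} f \<and> (\<forall>c. int_comb G {..<r} f c = \<one>\<^bsub>G\<^esub> \<longleftrightarrow> (\<forall>i<r. m dvd c i)))"

lemma homocyclic_imp_comm_group: "homocyclic m r G \<Longrightarrow> comm_group G"
  by (simp add: homocyclic_def)

lemma homocyclicE:
  assumes "homocyclic m r G"
  obtains f where "comm_group G" "spans G {..<r} f"
    "\<And>c. int_comb G {..<r} f c = \<one>\<^bsub>G\<^esub> \<longleftrightarrow> (\<forall>i<r. m dvd c i)"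
  using assms by (auto simp: homocyclic_def)

text \<open>A generating family of least length is independent, since a nontrivial relation would
  shorten it.\<close>

lemma (in comm_group) torsion_free_homocyclic:
  assumes "spans G I f"
    and tf: "\<And>x k. x \<in> carrier G \<Longrightarrow> k \<noteq> 0 \<Longrightarrow> x [^] (k::int) = \<one> \<Longrightarrow> x = \<one>"
  shows "\<exists>r\<le>card I. homocyclic 0 r G"
proof -
  define P where "P r \<longleftrightarrow> (\<exists>f :: nat \<Rightarrow> 'a. spans G {..<r} f)" for r
  define r where "r = (LEAST r. P r)"
  have P: "P (card I)" using spans_reindex[OF assms(1)] unfolding P_def by blast
  have "P r" "r \<le> card I" unfolding r_def by (auto intro: LeastI[of P, OF P] Least_le[of P, OF P])
  then obtain f where f: "spans G {..<r} f" unfolding P_def by blast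
  have "\<forall>i<r. c i = 0" if rel: "int_comb G {..<r} f c = \<one>" for c
  proof (rule ccontr)
    assume "\<not> ?thesis"
    then have "\<exists>i\<in>{..<r}. c i \<noteq> 0" by auto
    then have "\<exists>i\<in>{..<r}. \<exists>g. spans G ({..<r} - {i}) g"
      by (rule spans_fewer_of_relation[OF f rel _ tf])
    then obtain i g where i: "i < r" "spans G ({..<r} - {i}) g" by blast
    then have "P (r - 1)" using spans_reindex[OF i(2)] unfolding P_def by auto
    then have "r \<le> r - 1" unfolding r_def by (rule Least_le)
    with i show False by simp
  qed
  then have "homocyclic 0 r G"
    unfolding homocyclic_def using f comm_group_axioms
    by (auto intro!: exI[of _ f] int_comb_zero)
  with \<open>r \<le> card I\<close> show ?thesis by blast
qed

text \<open>Again a shortest generating family is taken. An odd power of \<open>f i\<close> is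
  \<open>f i\<close> itself, so a relation with an odd coefficient would express that generator by
  the others.\<close>

lemma (in comm_group) elementary_homocyclic:
  assumes "spans G I f" and el: "\<And>x. x \<in> carrier G \<Longrightarrow> x \<otimes> x = \<one>"
  shows "\<exists>r\<le>card I. homocyclic 2 r G"
proof -
  define P where "P r \<longleftrightarrow> (\<exists>f :: nat \<Rightarrow> 'a. spans G {..<r} f)" for r
  define r where "r = (LEAST r. P r)"
  have P: "P (card I)" using spans_reindex[OF assms(1)] unfolding P_def by blast
  have "P r" "r \<le> card I" unfolding r_def by (auto intro: LeastI[of P, OF P] Least_le[of P, OF P])
  then obtain f where f: "spans G {..<r} f" unfolding P_def by blast
  note s = spansD[OF f]
  have sq: "x [^] (2 * k :: int) = \<one>" if "x \<in> carrier G" for x k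
  proof -
    have "x [^] (2 * k) = (x [^] k) \<otimes> (x [^] k)"
      using that by (simp add: int_pow_mult[symmetric])
    then show ?thesis using el that by simp
  qed
  have "\<forall>i<r. 2 dvd c i" if rel: "int_comb G {..<r} f c = \<one>" for c
  proof (rule ccontr)
    assume "\<not> ?thesis"
    then obtain i where i: "i < r" "odd (c i)" by blast
    then obtain k where k: "c i = 2 * k + 1" by (auto elim: oddE)
    have fi: "f i \<in> carrier G" using s i by auto
    have "f i [^] c i = f i" using fi int_pow_mult[of "f i" "2 * k" 1] by (simp add: k sq)
    then have "spans G ({..<r} - {i}) f" using spans_drop_of_relation[OF f _ rel] i by auto
    then have "P (r - 1)" using spans_reindex i(1) unfolding P_def by fastforce
    then have "r \<le> r - 1" unfolding r_def by (rule Least_le)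
    with i show False by simp
  qed
  moreover have "int_comb G {..<r} f c = \<one>" if "\<forall>i<r. 2 dvd c i" for c
    unfolding int_comb_def
  proof (rule finprod_one_eqI)
    fix i assume "i \<in> {..<r}"
    then have "2 dvd c i" "f i \<in> carrier G" using that s(2) by auto
    then obtain k where "c i = 2 * k" "f i \<in> carrier G" by (elim evenE)
    then show "f i [^] c i = \<one>" using sq by simp
  qed
  ultimately have "homocyclic 2 r G"
    unfolding homocyclic_def using f comm_group_axioms by blast
  with \<open>r \<le> card I\<close> show ?thesis by blast
qed

section \<open>Isomorphism invariance, uniqueness and rank of homocyclic groups\<close>

lemma int_comb_hom:
  assumes "comm_group G" "comm_group H" "h \<in> hom G H" "finite I" "f ` I \<subseteq> carrier G"
  shows "h (int_comb G I f c) = int_comb H I (\<lambda>i. h (f i)) c"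
proof -
  interpret G: comm_group G by fact
  interpret H: comm_group H by fact
  interpret group_hom G H h by unfold_locales fact
  have "h (int_comb G J f c) = int_comb H J (\<lambda>i. h (f i)) c" if "finite J" "J \<subseteq> I" for J
    using that
  proof (induction J)
    case empty
    show ?case by (simp add: int_comb_def)
  next
    case (insert i J)
    have f: "f j \<in> carrier G" if "j \<in> insert i J" for j
      using that insert.prems(1) assms(5) by (auto simp: image_subset_iff)
    have "int_comb G (insert i J) f c = f i [^]\<^bsub>G\<^esub> c i \<otimes>\<^bsub>G\<^esub> int_comb G J f c"
      unfolding int_comb_def using f insert.hyps by (intro G.finprod_insert) simp_all
    then have "h (int_comb G (insert i J) f c) = h (f i) [^]\<^bsub>H\<^esub> c i \<otimes>\<^bsub>H\<^esub> h (int_comb G J f c)"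
      using f by (simp add: image_subset_iff hom_int_pow)
    also have "\<dots> = h (f i) [^]\<^bsub>H\<^esub> c i \<otimes>\<^bsub>H\<^esub> int_comb H J (\<lambda>i. h (f i)) c"
      using insert by simp
    also have "\<dots> = int_comb H (insert i J) (\<lambda>i. h (f i)) c"
      unfolding int_comb_def using f insert.hyps
      by (intro H.finprod_insert[symmetric]) simp_all
    finally show ?case .
  qed
  then show ?thesis using assms(4) by blast
qed

lemma homocyclic_iso:
  assumes "homocyclic m r H" "comm_group G" "H \<cong> G"
  shows "homocyclic m r G"
proof -
  obtain f where H: "comm_group H" and f: "spans H {..<r} f"
    and rel: "\<And>c. int_comb H {..<r} f c = \<one>\<^bsub>H\<^esub> \<longleftrightarrow> (\<forall>i<r. m dvd c i)"
    by (rule homocyclicE[OF assms(1)]) (rule that)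
  obtain h where h: "h \<in> hom H G" "h ` carrier H = carrier G" "inj_on h (carrier H)"
    using assms(3) by (auto simp: is_iso_def iso_iff)
  interpret G: comm_group G by fact
  interpret H: comm_group H by fact
  interpret group_hom H G h by unfold_locales fact
  note s = spansD[OF f]
  have "generate G ((\<lambda>i. h (f i)) ` {..<r}) = carrier G"
    using generate_img[OF s(2)] s(3) h(2) by (simp add: image_image)
  then have "spans G {..<r} (\<lambda>i. h (f i))" using s h(2) by (auto simp: spans_def)
  moreover have "int_comb G {..<r} (\<lambda>i. h (f i)) c = \<one>\<^bsub>G\<^esub> \<longleftrightarrow> (\<forall>i<r. m dvd c i)" for c
  proof -
    have "h (int_comb H {..<r} f c) = h \<one>\<^bsub>H\<^esub> \<longleftrightarrow> int_comb H {..<r} f c = \<one>\<^bsub>H\<^esub>"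
      by (rule inj_on_eq_iff[OF h(3)]) (use s(2) in auto)
    then show ?thesis
      by (simp only: int_comb_hom[OF H assms(2) h(1) s(1,2)] rel hom_one)
  qed
  ultimately show ?thesis using assms(2) unfolding homocyclic_def by blast
qed

text \<open>In either group two combinations agree exactly if their coefficients are congruent
  modulo \<open>m\<close>. Hence carrying the coefficients over is well defined and injective,
  whatever coefficients \<open>SOME\<close> selects.\<close>

lemma homocyclic_unique:
  assumes "homocyclic m r G" "homocyclic m r H"
  shows "G \<cong> H"
proof -
  obtain f where G: "comm_group G" and f: "spans G {..<r} f"
    and relf: "\<And>c. int_comb G {..<r} f c = \<one>\<^bsub>G\<^esub> \<longleftrightarrow> (\<forall>i<r. m dvd c i)"
    by (rule homocyclicE[OF assms(1)]) (rule that)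
  obtain g where H: "comm_group H" and g: "spans H {..<r} g"
    and relg: "\<And>c. int_comb H {..<r} g c = \<one>\<^bsub>H\<^esub> \<longleftrightarrow> (\<forall>i<r. m dvd c i)"
    by (rule homocyclicE[OF assms(2)]) (rule that)
  interpret G: comm_group G by fact
  interpret H: comm_group H by fact
  note sf = spansD[OF f] and sg = spansD[OF g]
  have eq: "int_comb G {..<r} f c = int_comb G {..<r} f d \<longleftrightarrow>
      int_comb H {..<r} g c = int_comb H {..<r} g d" for c d
    by (simp only: G.int_comb_diff_eq_one_iff[OF sf(2), symmetric]
        H.int_comb_diff_eq_one_iff[OF sg(2), symmetric] relf relg)
  define \<phi> where "\<phi> x = int_comb H {..<r} g (SOME c. int_comb G {..<r} f c = x)" for x
  have \<phi>: "\<phi> (int_comb G {..<r} f c) = int_comb H {..<r} g c" for c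
    unfolding \<phi>_def eq[symmetric] by (rule someI[of "\<lambda>d. int_comb G {..<r} f d = int_comb G {..<r} f c"]) (rule refl)
  have "\<phi> \<in> iso G H"
    unfolding iso_iff
  proof (intro conjI homI inj_onI equalityI subsetI)
    fix x assume "x \<in> carrier G"
    then show "\<phi> x \<in> carrier H" using sg(2) by (simp add: \<phi>_def)
  next
    fix x y assume "x \<in> carrier G" "y \<in> carrier G"
    then obtain c d where "x = int_comb G {..<r} f c" "y = int_comb G {..<r} f d"
      by (metis G.spans_obtain[OF f])
    then show "\<phi> (x \<otimes>\<^bsub>G\<^esub> y) = \<phi> x \<otimes>\<^bsub>H\<^esub> \<phi> y"
      by (simp add: \<phi> G.int_comb_add[OF sf(2), symmetric] H.int_comb_add[OF sg(2), symmetric])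
  next
    fix y assume "y \<in> carrier H"
    then obtain c where "y = \<phi> (int_comb G {..<r} f c)" by (metis H.spans_obtain[OF g] \<phi>)
    then show "y \<in> \<phi> ` carrier G" using sf(2) by simp
  next
    fix y assume "y \<in> \<phi> ` carrier G"
    then show "y \<in> carrier H" using sg(2) by (auto simp: \<phi>_def)
  next
    fix x y assume "x \<in> carrier G" "y \<in> carrier G" "\<phi> x = \<phi> y"
    then show "x = y" by (metis G.spans_obtain[OF f] \<phi> eq)
  qed
  then show ?thesis by (rule is_isoI)
qed

text \<open>A dependency between the coordinates of \<open>s\<close> independent elements over \<open>r < s\<close> generators,
  made primitive by halving, is a relation with an odd coefficient.\<close>

lemma homocyclic_rank_le:
  assumes "homocyclic m r G" "homocyclic m' s G" "even m'"
  shows "s \<le> r"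
proof (rule ccontr)
  assume "\<not> s \<le> r"
  then have less: "card {..<r} < card {..<s}" by simp
  obtain f where G: "comm_group G" and f: "spans G {..<r} f"
    using assms(1) unfolding homocyclic_def by blast
  obtain g where "comm_group G" and g: "spans G {..<s} g"
    and relg: "\<And>c. int_comb G {..<s} g c = \<one>\<^bsub>G\<^esub> \<longleftrightarrow> (\<forall>i<s. m' dvd c i)"
    by (rule homocyclicE[OF assms(2)]) (rule that)
  interpret G: comm_group G by fact
  note sf = spansD[OF f] and sg = spansD[OF g]
  have "\<forall>i. \<exists>c. i < s \<longrightarrow> g i = int_comb G {..<r} f c"
  proof
    fix i show "\<exists>c. i < s \<longrightarrow> g i = int_comb G {..<r} f c"
    proof (cases "i < s")
      case True
      then have "g i \<in> carrier G" using sg(2) by auto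
      then obtain c where "g i = int_comb G {..<r} f c" by (rule G.spans_obtain[OF f])
      then show ?thesis by blast
    qed simp
  qed
  then obtain a where a: "\<And>i. i < s \<Longrightarrow> g i = int_comb G {..<r} f (a i)" by metis
  have comb: "int_comb G J g c = int_comb G {..<r} f (\<lambda>j. \<Sum>i\<in>J. a i j * c i)"
    if "finite J" "J \<subseteq> {..<s}" for J c
    using that
  proof (induction J)
    case empty
    have "int_comb G {} g c = \<one>\<^bsub>G\<^esub>" by (simp add: int_comb_def)
    then show ?case by (simp add: G.int_comb_zero)
  next
    case (insert i J)
    have "int_comb G (insert i J) g c = g i [^]\<^bsub>G\<^esub> c i \<otimes>\<^bsub>G\<^esub> int_comb G J g c"
      unfolding int_comb_def by (rule G.finprod_insert) (use insert sg in auto)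
    also have "g i [^]\<^bsub>G\<^esub> c i = int_comb G {..<r} f (\<lambda>j. c i * a i j)"
      using insert.prems a[of i] G.int_comb_scale[OF sf(2), of "c i" "a i"] by simp
    also have "int_comb G J g c = int_comb G {..<r} f (\<lambda>j. \<Sum>i\<in>J. a i j * c i)"
      using insert by simp
    finally show ?case
      using insert.hyps by (simp add: G.int_comb_add[OF sf(2), symmetric] mult.commute[of "c i"])
  qed
  \<comment> \<open>Descent: a solution is a relation between the \<open>g i\<close>, hence even,
    and its half solves the same system. The coordinates \<open>a i\<close> need not be unique, but
    sums that vanish in the integers always give a relation.\<close>
  have no: "\<not> (\<exists>i<s. c i \<noteq> 0)" if "\<forall>j\<in>{..<r}. (\<Sum>i<s. a i j * c i) = 0" for c
    using that
  proof (induction "nat (\<Sum>i<s. \<bar>c i\<bar>)" arbitrary: c rule: less_induct)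
    case less
    have "int_comb G {..<s} g c = \<one>\<^bsub>G\<^esub>"
      unfolding comb[OF finite_lessThan subset_refl] using less.prems
      by (intro G.int_comb_zero) auto
    then have "\<forall>i<s. even (c i)" using relg assms(3) dvd_trans by blast
    then have c: "\<And>i. i < s \<Longrightarrow> 2 * (c i div 2) = c i" by simp
    show ?case
    proof
      assume nz: "\<exists>i<s. c i \<noteq> 0"
      let ?d = "\<lambda>i. c i div 2"
      have sum: "(\<Sum>i<s. \<bar>c i\<bar>) = 2 * (\<Sum>i<s. \<bar>?d i\<bar>)"
        unfolding sum_distrib_left 
        by (rule sum.cong[OF refl]) (metis c abs_mult abs_numeral lessThan_iff)
      have "(\<Sum>i<s. \<bar>c i\<bar>) > 0"
        using nz by (meson abs_ge_zero finite_lessThan lessThan_iff sum_pos2 zero_less_abs_iff)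
      then have "nat (\<Sum>i<s. \<bar>?d i\<bar>) < nat (\<Sum>i<s. \<bar>c i\<bar>)" using sum by simp
      moreover have "\<forall>j\<in>{..<r}. (\<Sum>i<s. a i j * ?d i) = 0"
      proof
        fix j assume "j \<in> {..<r}"
        have "(\<Sum>i<s. a i j * c i) = 2 * (\<Sum>i<s. a i j * ?d i)"
          unfolding sum_distrib_left 
          by (rule sum.cong[OF refl]) (metis c lessThan_iff mult.left_commute)
        then show "(\<Sum>i<s. a i j * ?d i) = 0" using less.prems \<open>j \<in> {..<r}\<close> by simp
      qed
      ultimately have "\<not> (\<exists>i<s. ?d i \<noteq> 0)" by (rule less.hyps)
      then have "c i = 0" if "i < s" for i using c[OF that] that by (metis mult_zero_right)
      then show False using nz by blast
    qed
  qed
  show False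
    using homogeneous_system_nonzero_solution[OF finite_lessThan finite_lessThan less, of "\<lambda>j i. a i j"] no
    by (meson lessThan_iff)
qed

text \<open>For \<open>s > 0\<close> the first generator of the second family would have order 2,
  and the first family excludes torsion.\<close>

lemma homocyclic_zero_two:
  assumes "homocyclic 0 r G" "homocyclic 2 s G"
  shows "s = 0"
proof (rule ccontr)
  assume "s \<noteq> 0"
  obtain f where G: "comm_group G" and f: "spans G {..<r} f"
    and relf: "\<And>c. int_comb G {..<r} f c = \<one>\<^bsub>G\<^esub> \<longleftrightarrow> (\<forall>i<r. 0 dvd c i)"
    by (rule homocyclicE[OF assms(1)]) (rule that)
  obtain g where "comm_group G" and g: "spans G {..<s} g"
    and relg: "\<And>c. int_comb G {..<s} g c = \<one>\<^bsub>G\<^esub> \<longleftrightarrow> (\<forall>i<s. 2 dvd c i)"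
    by (rule homocyclicE[OF assms(2)]) (rule that)
  interpret G: comm_group G by fact
  note sf = spansD[OF f] and sg = spansD[OF g]
  have g0: "g 0 [^]\<^bsub>G\<^esub> (k::int) = \<one>\<^bsub>G\<^esub> \<longleftrightarrow> even k" for k
    using G.int_comb_unit[OF sg(1) _ sg(2), of 0 k] relg[of "\<lambda>j. if j = 0 then k else 0"] \<open>s \<noteq> 0\<close>
    by auto
  have g0c: "g 0 \<in> carrier G" using sg(2) \<open>s \<noteq> 0\<close> by auto
  then obtain c where c: "g 0 = int_comb G {..<r} f c" using G.spans_obtain[OF f] by blast
  have "int_comb G {..<r} f (\<lambda>i. 2 * c i) = \<one>\<^bsub>G\<^esub>"
    using g0[of 2] c by (simp add: G.int_comb_scale[OF sf(2)])
  then have "int_comb G {..<r} f c = \<one>\<^bsub>G\<^esub>" unfolding relf by auto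
  then have "g 0 [^]\<^bsub>G\<^esub> (1::int) = \<one>\<^bsub>G\<^esub>" using c by simp
  then show False using g0[of 1] by simp
qed

section \<open>Identification of \<open>FA\<close> and \<open>EA2\<close> with homocyclic
  groups\<close>

lemma homocyclic_free_Abelian_group: "homocyclic 0 r (free_Abelian_group {..<r})"
proof -
  let ?F = "free_Abelian_group {..<r}"
  interpret F: comm_group ?F by (rule abelian_free_Abelian_group)
  have cl: "frag_of ` {..<r} \<subseteq> carrier ?F" by auto
  have comb: "int_comb ?F J frag_of c = (\<Sum>i\<in>J. frag_cmul (c i) (frag_of i))"
    if "finite J" "J \<subseteq> {..<r}" for J c
    using that
  proof (induction J)
    case empty
    show ?case by (simp add: int_comb_def)
  next
    case (insert i J)
    have "int_comb ?F (insert i J) frag_of c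
        = frag_of i [^]\<^bsub>?F\<^esub> c i \<otimes>\<^bsub>?F\<^esub> int_comb ?F J frag_of c"
      unfolding int_comb_def
      by (rule F.finprod_insert) (use insert in \<open>auto intro!: F.int_pow_closed
          simp del: int_pow_free_Abelian_group carrier_free_Abelian_group_iff simp: cl[unfolded image_subset_iff]\<close>)
    then show ?case using insert by simp
  qed
  have coeff: "Poly_Mapping.lookup (\<Sum>i\<in>J. frag_cmul (c i) (frag_of i)) j = (if j \<in> J then c j else 0)"
    if "finite J" for J c and j :: nat
    using that by (induction J) (auto simp: lookup_add)
  have "x \<in> generate ?F (frag_of ` {..<r})" if x: "x \<in> carrier ?F" for x
  proof -
    have "Poly_Mapping.keys x \<subseteq> {..<r}" using x by simp
    then have "Poly_Mapping.lookup x j = 0" if "\<not> j < r" for j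
      using that by (metis in_keys_iff lessThan_iff subsetD)
    then have "x = int_comb ?F {..<r} frag_of (Poly_Mapping.lookup x)"
      by (intro poly_mapping_eqI) (simp add: comb coeff)
    then show ?thesis using F.generate_eq_range_int_comb[OF finite_lessThan cl] by blast
  qed
  then have "spans ?F {..<r} frag_of" using cl by (intro F.spansI) auto
  moreover have "int_comb ?F {..<r} frag_of c = \<one>\<^bsub>?F\<^esub> \<longleftrightarrow> (\<forall>i<r. 0 dvd c i)" for c
  proof
    assume "int_comb ?F {..<r} frag_of c = \<one>\<^bsub>?F\<^esub>"
    then have "(\<Sum>i<r. frag_cmul (c i) (frag_of i)) = 0" by (simp add: comb)
    then show "\<forall>i<r. 0 dvd c i"
      using coeff[of "{..<r}" c] by (metis dvd_refl finite_lessThan lessThan_iff lookup_zero)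
  next
    assume "\<forall>i<r. 0 dvd c i"
    then show "int_comb ?F {..<r} frag_of c = \<one>\<^bsub>?F\<^esub>" by (intro F.int_comb_zero) auto
  qed
  ultimately show ?thesis unfolding homocyclic_def using F.comm_group_axioms by blast
qed

lemma FA_eq: "FA m = {G. \<exists>r\<le>m. homocyclic 0 r G}"
proof -
  have "homocyclic 0 r G \<longleftrightarrow> comm_group G \<and> G \<cong> free_Abelian_group {..<r}" for r and G :: "('a, 'b) monoid_scheme"
  proof
    assume "homocyclic 0 r G"
    then show "comm_group G \<and> G \<cong> free_Abelian_group {..<r}"
      using homocyclic_unique homocyclic_free_Abelian_group homocyclic_imp_comm_group by blast
  next
    assume G: "comm_group G \<and> G \<cong> free_Abelian_group {..<r}"
    then have "free_Abelian_group {..<r} \<cong> G" by (simp add: group.iso_sym comm_group.axioms)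
    with G show "homocyclic 0 r G"
      using homocyclic_iso homocyclic_free_Abelian_group by blast
  qed
  then show ?thesis unfolding FA_def by blast
qed

lemma EA2_eq: "EA2 n = {G. \<exists>r\<le>n. homocyclic 2 r G}"
proof (intro equalityI subsetI)
  fix G :: "('a, 'b) monoid_scheme"
  assume "G \<in> EA2 n"
  then have G: "comm_group G" "\<And>x. x \<in> carrier G \<Longrightarrow> x \<otimes>\<^bsub>G\<^esub> x = \<one>\<^bsub>G\<^esub>"
    and rank: "group_rank G \<le> enat n"
    by (auto simp: EA2_def elementary_abelian_2_group_def)
  interpret comm_group G by fact
  \<comment> \<open>The strict form of the bound lets \<open>INF_less_iff\<close> produce an actual
    generating set.\<close>
  have "group_rank G < enat (Suc n)" using rank by (simp add: order.strict_trans1)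
  then obtain S where S: "S \<subseteq> carrier G" "finite S" "generate G S = carrier G" "card S \<le> n"
    unfolding group_rank_def INF_less_iff mem_Collect_eq enat_ord_simps less_Suc_eq_le by blast
  then have "spans G S (\<lambda>x. x)" by (simp add: spans_def)
  from elementary_homocyclic[OF this G(2)] obtain r where "r \<le> card S" "homocyclic 2 r G"
    by blast
  moreover from this S(4) have "r \<le> n" by simp
  ultimately show "G \<in> {G. \<exists>r\<le>n. homocyclic 2 r G}" by blast
next
  fix G :: "('a, 'b) monoid_scheme"
  assume "G \<in> {G. \<exists>r\<le>n. homocyclic 2 r G}"
  then obtain r where r: "r \<le> n" "homocyclic 2 r G" by blast
  obtain f where G: "comm_group G" and f: "spans G {..<r} f"
    and relf: "\<And>c. int_comb G {..<r} f c = \<one>\<^bsub>G\<^esub> \<longleftrightarrow> (\<forall>i<r. 2 dvd c i)"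
    by (rule homocyclicE[OF r(2)]) (rule that)
  interpret comm_group G by fact
  note s = spansD[OF f]
  have "x \<otimes>\<^bsub>G\<^esub> x = \<one>\<^bsub>G\<^esub>" if x: "x \<in> carrier G" for x
  proof -
    obtain c where c: "x = int_comb G {..<r} f c" by (rule spans_obtain[OF f x])
    show ?thesis unfolding c int_comb_add[OF s(2), symmetric] relf by simp
  qed
  moreover have "group_rank G \<le> enat n"
  proof -
    have "group_rank G \<le> enat (card (f ` {..<r}))"
      unfolding group_rank_def by (rule INF_lower) (use s in auto)
    also have "card (f ` {..<r}) \<le> n"
      using card_image_le[OF s(1), of f] r(1) by simp
    finally show ?thesis by simp
  qed
  ultimately show "G \<in> EA2 n" using G by (auto simp: EA2_def elementary_abelian_2_group_def)
qed


section \<open>Abelian self-similar groups over the binary alphabet\<close>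

text \<open>If \<open>u\<close> is the transition along one letter, this describes how the weights
  move in one step of the walk.\<close>

lemma (in comm_group) int_comb_pushforward:
  assumes "finite Q" "f ` Q \<subseteq> carrier G" "u ` Q \<subseteq> Q"
  shows "int_comb G Q (\<lambda>q. f (u q)) c = int_comb G Q f (\<lambda>p. \<Sum>q\<in>Q. if u q = p then c q else 0)"
proof -
  have "int_comb G J (\<lambda>q. f (u q)) c = int_comb G Q f (\<lambda>p. \<Sum>q\<in>J. if u q = p then c q else 0)"
    if "finite J" "J \<subseteq> Q" for J
    using that
  proof (induction J)
    case empty
    have "int_comb G {} (\<lambda>q. f (u q)) c = \<one>" by (simp add: int_comb_def)
    then show ?case by (simp add: int_comb_zero)
  next
    case (insert q J)
    have f: "f (u j) \<in> carrier G" if "j \<in> insert q J" for j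
      using that insert.prems assms(2,3) by (auto simp: image_subset_iff)
    have uq: "u q \<in> Q" using insert.prems assms(3) by auto
    have "int_comb G (insert q J) (\<lambda>q. f (u q)) c
        = f (u q) [^] c q \<otimes> int_comb G J (\<lambda>q. f (u q)) c"
      unfolding int_comb_def using f insert.hyps by (intro finprod_insert) simp_all
    also have "f (u q) [^] c q = int_comb G Q f (\<lambda>p. if p = u q then c q else 0)"
      by (rule int_comb_unit[OF assms(1) uq assms(2), symmetric])
    also have "(\<lambda>p. if p = u q then c q else 0) = (\<lambda>p. if u q = p then c q else 0)" by auto
    also have "int_comb G J (\<lambda>q. f (u q)) c =
        int_comb G Q f (\<lambda>p. \<Sum>q\<in>J. if u q = p then c q else 0)"
      using insert by simp
    finally show ?case
      using insert.hyps by (simp add: int_comb_add[OF assms(2), symmetric])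
  qed
  then show ?thesis using assms(1) by blast
qed

text \<open>The Boolean \<open>b\<close> stands for a letter; an active element swaps the two letters at the root, and
  \<open>sec b x\<close> is the section of \<open>x\<close> at \<open>b\<close>.\<close>

locale self_similar_comm_group = comm_group G for G (structure) +
  fixes active :: "'a \<Rightarrow> bool" and sec :: "bool \<Rightarrow> 'a \<Rightarrow> 'a"
  assumes sec_closed [simp]: "x \<in> carrier G \<Longrightarrow> sec b x \<in> carrier G"
    and active_mult: "\<lbrakk>x \<in> carrier G; y \<in> carrier G\<rbrakk> \<Longrightarrow> active (x \<otimes> y) \<longleftrightarrow> active x \<noteq> active y"
    and sec_mult: "\<lbrakk>x \<in> carrier G; y \<in> carrier G\<rbrakk> \<Longrightarrow>
      sec b (x \<otimes> y) = sec (b \<noteq> active y) x \<otimes> sec b y"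
    and faithful: "\<lbrakk>S \<subseteq> carrier G; \<And>x. x \<in> S \<Longrightarrow> \<not> active x; \<And>x b. x \<in> S \<Longrightarrow> sec b x \<in> S; x \<in> S\<rbrakk>
      \<Longrightarrow> x = \<one>"
begin

lemma inactive_one: "\<not> active \<one>"
  using active_mult[of \<one> \<one>] by simp

lemma sec_one: "sec b \<one> = \<one>"
  using sec_mult[of \<one> \<one> b] sec_closed[of \<one> b] inactive_one by simp

lemma inactive_square: "x \<in> carrier G \<Longrightarrow> \<not> active (x \<otimes> x)"
  by (simp add: active_mult)

text \<open>In \<open>x \<otimes> a\<close> the letter is swapped before \<open>x\<close> meets it,
  in \<open>a \<otimes> x\<close> it is not; commutativity equates the two situations.\<close>

lemma sec_eq_of_inactive:
  assumes a: "a \<in> carrier G" "active a" and x: "x \<in> carrier G" "\<not> active x"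
  shows "sec b x = sec (\<not> b) x"
proof -
  have "sec b a \<otimes> sec b x = sec b (a \<otimes> x)" using a x by (simp add: sec_mult)
  also have "\<dots> = sec b (x \<otimes> a)" using a x by (simp add: m_comm)
  also have "\<dots> = sec (\<not> b) x \<otimes> sec b a" using a x by (simp add: sec_mult)
  also have "\<dots> = sec b a \<otimes> sec (\<not> b) x" using a x by (simp add: m_comm)
  finally show ?thesis using a x by simp
qed

lemma sec_nat_pow:
  assumes "x \<in> carrier G" "\<not> active x"
  shows "\<not> active (x [^] (k::nat)) \<and> sec b (x [^] k) = sec b x [^] k"
  using assms by (induction k) (auto simp: inactive_one sec_one active_mult sec_mult)

lemma active_nat_pow:
  "x \<in> carrier G \<Longrightarrow> active (x [^] (k::nat)) \<longleftrightarrow> active x \<and> odd k"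
  by (induction k) (auto simp: inactive_one active_mult)

lemma elementary_of_active_involution:
  assumes h: "h \<in> carrier G" "active h" "h \<otimes> h = \<one>" and x: "x \<in> carrier G"
  shows "x \<otimes> x = \<one>"
proof (rule faithful[where S = "(\<lambda>x. x \<otimes> x) ` carrier G"])
  fix y b assume "y \<in> (\<lambda>x. x \<otimes> x) ` carrier G"
  then obtain z where z: "z \<in> carrier G" "y = z \<otimes> z" by blast
  have sq: "sec b (w \<otimes> w) = sec b w \<otimes> sec b w" if "w \<in> carrier G" "\<not> active w" for w
    using that by (simp add: sec_mult)
  have "\<exists>w\<in>carrier G. \<not> active w \<and> y = w \<otimes> w"
  proof (cases "active z")
    case True
    \<comment> \<open>An active root \<open>z\<close> is replaced by the inactive root
      \<open>z \<otimes> h\<close> of the same square. For an inactive root the section of the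
      square is the square of the section.\<close>
    have "z \<otimes> h \<otimes> (z \<otimes> h) = z \<otimes> z \<otimes> (h \<otimes> h)" using z(1) h(1) by (simp add: m_ac)
    then show ?thesis using z h True by (intro bexI[of _ "z \<otimes> h"]) (auto simp: active_mult)
  qed (use z in blast)
  then show "sec b y \<in> (\<lambda>x. x \<otimes> x) ` carrier G" using sq by auto
qed (use x inactive_square in auto)

lemma torsion_free_of_no_active_involution:
  assumes no: "\<And>h. h \<in> carrier G \<Longrightarrow> active h \<Longrightarrow> h \<otimes> h \<noteq> \<one>"
    and x: "x \<in> carrier G" and k: "k \<noteq> 0" "x [^] (k::int) = \<one>"
  shows "x = \<one>"
proof -
  have two: "y = \<one>" if "y \<in> carrier G" "y \<otimes> y = \<one>" for y
  proof (rule faithful[where S = "{y \<in> carrier G. y \<otimes> y = \<one>}"])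
    fix z b assume z: "z \<in> {y \<in> carrier G. y \<otimes> y = \<one>}"
    then show inact: "\<not> active z" using no by blast
    have "sec b z \<otimes> sec b z = sec b (z \<otimes> z)" using sec_mult[of z z b] z inact by auto
    then show "sec b z \<in> {y \<in> carrier G. y \<otimes> y = \<one>}" using z by (simp add: sec_one)
  qed (use that in auto)
  \<comment> \<open>Strong induction on the exponent. Even exponents are halved with
    \<open>two\<close>. For an odd exponent \<open>m\<close>, an active element has an active
    \<open>m\<close>-th power, so all solutions of \<open>y [^] m = \<one>\<close> are inactive and
    \<open>faithful\<close> applies to the set of them.\<close>
  have nat: "y = \<one>" if "y \<in> carrier G" "m > 0" "y [^] (m::nat) = \<one>" for y m
    using that
  proof (induction m arbitrary: y rule: less_induct)
    case (less m)
    show ?case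
    proof (cases "even m")
      case True
      then obtain l where l: "m = l + l" by (metis evenE mult_2)
      then have "y [^] l \<otimes> y [^] l = \<one>" using less.prems by (simp add: nat_pow_mult)
      then have "y [^] l = \<one>" by (rule two[OF nat_pow_closed[OF less.prems(1)]])
      moreover have "l < m" "0 < l" using l less.prems(2) by auto
      ultimately show ?thesis using less.IH less.prems(1) by blast
    next
      case False
      let ?S = "{y \<in> carrier G. y [^] m = \<one>}"
      have inact: "\<not> active z" if "z \<in> ?S" for z
        using that active_nat_pow[of z m] False inactive_one by auto
      show ?thesis
      proof (rule faithful[where S = ?S])
        fix z b assume z: "z \<in> ?S"
        then show "sec b z \<in> ?S" using sec_nat_pow[of z m b] inact[OF z] by (simp add: sec_one)
      qed (use inact less.prems in auto)
    qed
  qed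
  have "x [^] \<bar>k\<bar> = \<one>"
    using k(2) int_pow_neg[OF x, of k] by (cases "k \<ge> 0") simp_all
  then have "x [^] nat \<bar>k\<bar> = \<one>"
    using int_pow_int[of G x "nat \<bar>k\<bar>"] by simp
  moreover have "0 < nat \<bar>k\<bar>" using k by simp
  ultimately show ?thesis using nat x by blast
qed

text \<open>For \<open>x\<close> the product of the states with the weights of a stationary distribution of the walk
  which moves from a state to one of its sections with equal probabilities, the product of the
  two sections of \<open>x\<close> is \<open>x \<otimes> x\<close>; but the sections of \<open>x \<otimes> x\<close> are equal to this same product.\<close>

lemma relation_of_stationary_distribution:
  assumes a: "a \<in> carrier G" "active a"
    and Q: "finite Q" "Q \<noteq> {}" "f ` Q \<subseteq> carrier G"
    and t: "\<And>b q. q \<in> Q \<Longrightarrow> t b q \<in> Q" "\<And>b q. q \<in> Q \<Longrightarrow> sec b (f q) = f (t b q)"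
  shows "\<exists>c. (\<exists>q\<in>Q. c q \<noteq> 0) \<and> int_comb G Q f c = \<one>"
proof -
  define D where "D x = sec True x \<otimes> sec False x" for x
  \<comment> \<open>An active \<open>y\<close> exchanges the sections of \<open>x\<close>, and their
    product is not affected by the exchange.\<close>
  have D_hom: "D \<in> hom G G"
  proof (rule homI)
    fix x y assume xy: "x \<in> carrier G" "y \<in> carrier G"
    then show "D (x \<otimes> y) = D x \<otimes> D y"
      by (cases "active y") (simp_all add: D_def sec_mult m_ac)
  qed (simp add: D_def)
  \<comment> \<open>For active \<open>x\<close> the two factors meet different letters, so both
    sections occur. For inactive \<open>x\<close> the same one occurs twice, but the two
    coincide.\<close>
  have sec_square: "sec b (x \<otimes> x) = D x" if x: "x \<in> carrier G" for x b
  proof -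
    have "sec b (x \<otimes> x) = sec b x \<otimes> sec (\<not> b) x"
      using x sec_eq_of_inactive[OF a x] by (cases "active x") (simp_all add: sec_mult m_comm)
    then show ?thesis using x by (cases b) (simp_all add: D_def m_comm)
  qed
  \<comment> \<open>\<open>N p q\<close> is twice the probability of moving from \<open>q\<close> to
    \<open>p\<close>; stationarity thus reads N c = 2 c over the integers.\<close>
  define N where "N p q = (if t True q = p then 1 else 0) + (if t False q = p then 1 else 0 :: int)"
    for p q
  obtain p0 where p0: "p0 \<in> Q" using Q by blast
  \<comment> \<open>The columns of N - 2 I have sum 0, so the equation at \<open>p0\<close> follows
    from the others. Without it there are fewer equations than unknowns, and a nonzero integer
    solution exists.\<close>
  have "card (Q - {p0}) < card Q" by (rule card_Diff1_less[OF Q(1) p0])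
  from homogeneous_system_nonzero_solution[OF _ Q(1) this,
      of "\<lambda>p q. N p q - (if q = p then 2 else 0)"]
  obtain c where c: "\<exists>q\<in>Q. c q \<noteq> 0"
    "\<And>p. p \<in> Q - {p0} \<Longrightarrow> (\<Sum>q\<in>Q. (N p q - (if q = p then 2 else 0)) * c q) = 0"
    using Q(1) by auto
  have colsum: "(\<Sum>p\<in>Q. N p q) = 2" if "q \<in> Q" for q
    using Q(1) t(1)[OF that] by (simp add: N_def sum.distrib)
  have "(\<Sum>p\<in>Q. \<Sum>q\<in>Q. (N p q - (if q = p then 2 else 0)) * c q) =
      (\<Sum>q\<in>Q. \<Sum>p\<in>Q. (N p q - (if q = p then 2 else 0)) * c q)"
    by (rule sum.swap)
  also have "\<dots> = (\<Sum>q\<in>Q. (\<Sum>p\<in>Q. N p q - (if q = p then 2 else 0)) * c q)"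
    by (simp add: sum_distrib_right)
  also have "\<dots> = 0"
    by (rule sum.neutral) (use Q(1) in \<open>simp add: sum_subtractf colsum\<close>)
  finally have "(\<Sum>q\<in>Q. (N p0 q - (if q = p0 then 2 else 0)) * c q) = 0"
    using c(2) by (simp add: sum.remove[OF Q(1) p0])
  with c(2) have "(\<Sum>q\<in>Q. (N p q - (if q = p then 2 else 0)) * c q) = 0" if "p \<in> Q" for p
    using that by (cases "p = p0") simp_all
  moreover have "(\<Sum>q\<in>Q. (N p q - (if q = p then 2 else 0)) * c q)
      = (\<Sum>q\<in>Q. N p q * c q) - 2 * c p" if "p \<in> Q" for p
  proof -
    have "(\<Sum>q\<in>Q. (N p q - (if q = p then 2 else 0)) * c q)
        = (\<Sum>q\<in>Q. N p q * c q) - (\<Sum>q\<in>Q. if q = p then 2 * c q else 0)"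
      unfolding sum_subtractf[symmetric] by (rule sum.cong) (auto simp: left_diff_distrib)
    then show ?thesis using Q(1) that by simp
  qed
  ultimately have stat: "(\<Sum>q\<in>Q. N p q * c q) = 2 * c p" if "p \<in> Q" for p
    using that by simp
  define x where "x = int_comb G Q f c"
  have x: "x \<in> carrier G" unfolding x_def by (rule int_comb_closed[OF Q(3)])
  have f: "f q \<in> carrier G" if "q \<in> Q" for q using that Q(3) by auto
  have "D x = int_comb G Q (\<lambda>q. D (f q)) c"
    unfolding x_def by (rule int_comb_hom[OF comm_group_axioms comm_group_axioms D_hom Q(1,3)])
  also have "\<dots> = finprod G (\<lambda>q. f (t True q) [^] c q \<otimes> f (t False q) [^] c q) Q"
    unfolding int_comb_def
    by (rule finprod_cong') (use f t in \<open>auto simp: D_def int_pow_distrib\<close>)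
  also have "\<dots> = int_comb G Q (\<lambda>q. f (t True q)) c \<otimes> int_comb G Q (\<lambda>q. f (t False q)) c"
    unfolding int_comb_def by (rule finprod_multf) (use f t(1) in auto)
  also have "\<dots> = int_comb G Q f (\<lambda>p. (\<Sum>q\<in>Q. if t True q = p then c q else 0)
      + (\<Sum>q\<in>Q. if t False q = p then c q else 0))"
    using Q t(1) by (simp add: int_comb_pushforward int_comb_add image_subset_iff)
  also have "\<dots> = int_comb G Q f (\<lambda>p. 2 * c p)"
  proof (rule int_comb_cong[OF Q(3) refl])
    fix p assume "p \<in> Q"
    have "(\<Sum>q\<in>Q. if t True q = p then c q else 0) + (\<Sum>q\<in>Q. if t False q = p then c q else 0)
        = (\<Sum>q\<in>Q. N p q * c q)"
      unfolding sum.distrib[symmetric] by (rule sum.cong) (auto simp: N_def)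
    then show "(\<Sum>q\<in>Q. if t True q = p then c q else 0)
        + (\<Sum>q\<in>Q. if t False q = p then c q else 0) = 2 * c p"
      using stat[OF \<open>p \<in> Q\<close>] by simp
  qed
  also have "\<dots> = x \<otimes> x"
    unfolding x_def int_comb_add[OF Q(3), symmetric] by (simp only: mult_2)
  finally have "D x = x \<otimes> x" .
  \<comment> \<open>Both sections of the inactive element \<open>x \<otimes> x\<close> are
    \<open>D x\<close>, which is \<open>x \<otimes> x\<close> again.\<close>
  then have "x \<otimes> x = \<one>"
    using x sec_square[OF x] inactive_square[OF x]
    by (intro faithful[where S = "{x \<otimes> x}"]) auto
  \<comment> \<open>Only the square of \<open>x\<close> is known to be trivial, hence the doubled
    coefficients.\<close>
  then have "int_comb G Q f (\<lambda>q. c q + c q) = \<one>"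
    by (simp only: int_comb_add[OF Q(3)] x_def)
  moreover have "\<exists>q\<in>Q. c q + c q \<noteq> 0" using c(1) by auto
  ultimately show ?thesis by (intro exI[of _ "\<lambda>q. c q + c q"] conjI)
qed

text \<open>If some square is nontrivial, no active involution exists, and the group is
  torsion-free. An active element does exist, since otherwise the whole group would be an inactive
  set closed under sections. The relation between the states then costs one index, whence the strict
  bound on \<open>r\<close>.\<close>

lemma homocyclic_cases:
  assumes sp: "spans G Q f"
    and t: "\<And>b q. q \<in> Q \<Longrightarrow> t b q \<in> Q" "\<And>b q. q \<in> Q \<Longrightarrow> sec b (f q) = f (t b q)"
  shows "(\<exists>r<card Q. homocyclic 0 r G) \<or> (\<exists>r\<le>card Q. homocyclic 2 r G)"
proof (cases "\<forall>x\<in>carrier G. x \<otimes> x = \<one>")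
  case True
  then show ?thesis using elementary_homocyclic[OF sp] by blast
next
  case False
  note s = spansD[OF sp]
  obtain a where a: "a \<in> carrier G" "active a"
  proof (rule ccontr)
    assume "\<not> thesis"
    then have "\<And>x. x \<in> carrier G \<Longrightarrow> \<not> active x" using that by blast
    then have "\<And>x. x \<in> carrier G \<Longrightarrow> x = \<one>" by (intro faithful[where S = "carrier G"]) auto
    then show False using False by auto
  qed
  have tf: "x = \<one>" if "x \<in> carrier G" "k \<noteq> 0" "x [^] (k::int) = \<one>" for x k
    using torsion_free_of_no_active_involution[OF _ that] elementary_of_active_involution False
    by metis
  have "Q \<noteq> {}"
  proof
    assume "Q = {}"
    then have "carrier G = {\<one>}" using s(3) generate_empty by simp
    then show False using a inactive_one by simp
  qed
  then obtain c where c: "\<exists>q\<in>Q. c q \<noteq> 0" "int_comb G Q f c = \<one>"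
    using relation_of_stationary_distribution[OF a s(1) _ s(2) t] by blast
  have "\<exists>q\<in>Q. \<exists>g. spans G (Q - {q}) g"
    by (rule spans_fewer_of_relation[OF sp c(2,1)]) (rule tf)
  then obtain q g where q: "q \<in> Q" "spans G (Q - {q}) g" by blast
  have "\<exists>r\<le>card (Q - {q}). homocyclic 0 r G"
    by (rule torsion_free_homocyclic[OF q(2)]) (rule tf)
  then obtain r where "r \<le> card (Q - {q})" "homocyclic 0 r G" by blast
  moreover from this q(1) s(1) have "r < card Q"
    using card_Diff1_less[OF s(1) q(1)] by simp
  ultimately show ?thesis by blast
qed

end


section \<open>Groups of binary automata\<close>

declare One_nat_def [simp del]

lemma tree_aut_group_mult:
  assumes "x \<in> carrier (tree_aut_group X)" "y \<in> carrier (tree_aut_group X)" "w \<in> lists X"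
  shows "(x \<otimes>\<^bsub>tree_aut_group X\<^esub> y) w = x (y w)"
  using assms by (simp add: tree_aut_group_def tree_automorphisms_def BijGroup_def compose_eq)

lemma tree_aut_group_one: "\<one>\<^bsub>tree_aut_group X\<^esub> = (\<lambda>w\<in>lists X. w)"
  by (simp add: tree_aut_group_def BijGroup_def)

lemma tree_aut_group_carrierD:
  assumes "x \<in> carrier (tree_aut_group X)"
  shows "x [] = []" "x \<in> extensional (lists X)" "bij_betw x (lists X) (lists X)"
    "w \<in> lists X \<Longrightarrow> x w \<in> lists X"
  using assms by (auto simp: tree_aut_group_def tree_automorphisms_def Bij_def bij_betw_def)

locale binary_mealy =
  fixes A :: "('q, nat) mealy"
  assumes automaton: "mealy_automaton A" and invertible: "invertible_mealy A"
    and binary: "alphabet A = {0, 1}"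
begin

abbreviation "L \<equiv> lists {0, 1 :: nat}"
abbreviation "T \<equiv> tree_aut_group {0, 1 :: nat}"
abbreviation "K \<equiv> mealy_group A"
abbreviation "gen q \<equiv> restrict (state_map A q) L"

section \<open>Sections in the group of a binary automaton\<close>

definition active :: "(nat list \<Rightarrow> nat list) \<Rightarrow> bool" where
  "active x \<longleftrightarrow> hd (x [0]) = 1"

definition sec :: "bool \<Rightarrow> (nat list \<Rightarrow> nat list) \<Rightarrow> nat list \<Rightarrow> nat list" where
  "sec b x = restrict (\<lambda>w. tl (x (of_bool b # w))) L"

lemma K_simps: "mult K = mult T" "one K = one T" "carrier K = generate T (gen ` states A)"
  by (simp_all add: mealy_group_def binary)

lemma gen_in_T: "q \<in> states A \<Longrightarrow> gen q \<in> carrier T"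
  using restrict_state_map_in_tree_aut_group[OF automaton invertible] by (simp add: binary)

lemma gens_subset: "gen ` states A \<subseteq> carrier T"
  using gen_in_T by blast

lemma subgroup_K: "subgroup (carrier K) T"
  unfolding K_simps by (rule group.generate_is_subgroup[OF group_tree_aut_group gens_subset])

lemma K_subset: "carrier K \<subseteq> carrier T"
  using subgroup_K by (rule subgroup.subset)

lemma group_K: "group K"
  using subgroup.subgroup_is_group[OF subgroup_K group_tree_aut_group]
  by (simp add: mealy_group_def binary)

lemma generate_K: "generate K (gen ` states A) = carrier K"
proof -
  have "generate (T\<lparr>carrier := carrier K\<rparr>) (gen ` states A) = generate T (gen ` states A)"
    by (rule group.generate_consistent[OF group_tree_aut_group _ subgroup_K])
      (auto simp: K_simps intro: generate.incl)
  then show ?thesis by (simp add: mealy_group_def binary)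
qed

lemma spans_gens: "spans K (states A) gen"
  unfolding spans_def using automaton generate_K
  by (auto simp: mealy_automaton_def K_simps intro: generate.incl)

lemma cons_in_L [simp]: "of_bool b # w \<in> L \<longleftrightarrow> w \<in> L"
  by (cases b) auto

lemma L_induct [consumes 1, case_names Nil Cons]:
  assumes "w \<in> L" "P []" "\<And>b w. w \<in> L \<Longrightarrow> P w \<Longrightarrow> P (of_bool b # w)"
  shows "P w"
  using assms(1)
proof (induction w)
  case (Cons a w)
  then have "a = of_bool (a = 1)" by auto
  then show ?case using assms(3)[of w "a = 1"] Cons by metis
qed (rule assms(2))

text \<open>This allows the sections of a product or an inverse to be determined by guessing
  them.\<close>

lemma sections_unique:
  assumes "\<And>b w. w \<in> L \<Longrightarrow> x (of_bool b # w) = of_bool (b \<noteq> s) # y b w"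
    and "\<And>b. y b \<in> extensional L"
  shows "active x = s" "sec b x = y b"
proof -
  have "x [0] = of_bool s # y False []" using assms(1)[of "[]" False] by simp
  then show "active x = s" by (simp add: active_def)
  show "sec b x = y b"
    by (rule extensionalityI[of _ L]) (use assms in \<open>auto simp: sec_def\<close>)
qed

text \<open>Induction on the generation of \<open>x\<close>. Both letters are treated at once,
  because a section of a product involves the section of its left factor at a possibly different
  letter.\<close>

lemma sections:
  assumes "x \<in> carrier K"
  shows "sec b x \<in> carrier K \<and> (\<forall>w\<in>L. x (of_bool b # w) = of_bool (b \<noteq> active x) # sec b x w)"
proof -
  interpret T: group T by (rule group_tree_aut_group)
  interpret K: subgroup "carrier K" T by (rule subgroup_K)
  have intro: "\<forall>b. sec b x \<in> carrier K \<and> (\<forall>w\<in>L. x (of_bool b # w) = of_bool (b \<noteq> active x) # sec b x w)"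
    if x: "\<And>b w. w \<in> L \<Longrightarrow> x (of_bool b # w) = of_bool (b \<noteq> s) # y b w" and y: "\<And>b. y b \<in> carrier K"
    for x s and y
  proof -
    have "y b \<in> extensional L" for b using y K_subset tree_aut_group_carrierD(2) by blast
    from sections_unique[OF x this] x y show ?thesis by simp
  qed
  \<comment> \<open>A permutation of two letters is addition modulo 2 of its value at 0, written as
    inequality of Booleans.\<close>
  have out: "out_fun A q (of_bool b) = of_bool (b \<noteq> (out_fun A q 0 = 1))"
    "trans_fun A q (of_bool b) \<in> states A" if "q \<in> states A" for q b
  proof -
    have "bij_betw (out_fun A q) {0, 1} {0, 1}"
      using invertible that by (simp add: invertible_mealy_def binary)
    then have "out_fun A q 0 \<in> {0, 1}" "out_fun A q 1 \<in> {0, 1}" "out_fun A q 0 \<noteq> out_fun A q 1"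
      by (auto simp: bij_betw_def inj_on_def)
    then show "out_fun A q (of_bool b) = of_bool (b \<noteq> (out_fun A q 0 = 1))" by (cases b) auto
    show "trans_fun A q (of_bool b) \<in> states A"
      using automaton that by (cases b) (auto simp: mealy_automaton_def binary)
  qed
  have gen_sec: "gen q (of_bool b # w) =
      of_bool (b \<noteq> (out_fun A q 0 = 1)) # gen (trans_fun A q (of_bool b)) w"
    if "q \<in> states A" "w \<in> L" for q b w
    using that out by simp
  have gen_K: "gen q \<in> carrier K" if "q \<in> states A" for q
    using that by (auto simp: K_simps intro: generate.incl)
  from assms have "x \<in> generate T (gen ` states A)" by (simp add: K_simps)
  then have "\<forall>b. sec b x \<in> carrier K \<and> (\<forall>w\<in>L. x (of_bool b # w) = of_bool (b \<noteq> active x) # sec b x w)"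
  proof induction
    case one
    show ?case
    proof (rule intro[where s = False and y = "\<lambda>_. \<one>\<^bsub>T\<^esub>"])
      show "\<one>\<^bsub>T\<^esub> \<in> carrier K" by (rule K.one_closed)
    qed (simp add: tree_aut_group_one)
  next
    case (incl h)
    then obtain q where q: "q \<in> states A" "h = gen q" by blast
    show ?case unfolding q(2)
      by (rule intro[where y = "\<lambda>b. gen (trans_fun A q (of_bool b))", OF gen_sec[OF q(1)]])
        (use gen_K out q in blast)+
  next
    case (inv h)
    then obtain q where q: "q \<in> states A" "h = gen q" by blast
    let ?s = "out_fun A q 0 = 1"
    \<comment> \<open>\<open>h\<close> maps the letter \<open>b \<noteq> ?s\<close> to
      \<open>b\<close>, so the section of its inverse at \<open>b\<close> inverts the section of
      \<open>h\<close> at \<open>b \<noteq> ?s\<close>.\<close>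
    let ?y = "\<lambda>b. inv\<^bsub>T\<^esub> gen (trans_fun A q (of_bool (b \<noteq> ?s)))"
    have inv_right: "g (m_inv T g w) = w" if "g \<in> carrier T" "w \<in> L" for g w
      using tree_aut_group_mult[OF that(1) T.inv_closed[OF that(1)] that(2)] that
      by (simp add: tree_aut_group_one)
    have h: "h \<in> carrier T" using q gen_in_T by simp
    have y: "?y b \<in> carrier K" for b using gen_K out(2)[OF q(1)] K.m_inv_closed by blast
    show ?case
    proof (rule intro[where s = ?s and y = ?y])
      fix b w assume w: "w \<in> L"
      let ?g = "gen (trans_fun A q (of_bool (b \<noteq> ?s)))"
      have g: "?g \<in> carrier T" using gen_in_T out(2)[OF q(1)] by blast
      have yw: "?y b w \<in> L"
        using y K_subset w tree_aut_group_carrierD(4) by blast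
      \<comment> \<open>As \<open>h\<close> is injective, it suffices to compare the images of both
        sides under \<open>h\<close>.\<close>
      have "h (of_bool (b \<noteq> ?s) # ?y b w) = of_bool b # ?g (?y b w)"
        unfolding q(2) gen_sec[OF q(1) yw] by (cases b; cases ?s) simp_all
      also have "\<dots> = of_bool b # w" using inv_right[OF g w] by simp
      also have "\<dots> = h ((inv\<^bsub>T\<^esub> h) (of_bool b # w))" using inv_right[OF h] w by simp
      finally show "(inv\<^bsub>T\<^esub> h) (of_bool b # w) = of_bool (b \<noteq> ?s) # ?y b w"
        using tree_aut_group_carrierD(3)[OF h] yw w
          tree_aut_group_carrierD(4)[OF T.inv_closed[OF h], of "of_bool b # w"]
        by (metis bij_betw_imp_inj_on cons_in_L inj_onD)
    qed (rule y)
  next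
    case (eng x y)
    then have xy: "x \<in> carrier K" "y \<in> carrier K" by (simp_all add: K_simps)
    then have xyT: "x \<in> carrier T" "y \<in> carrier T" using K_subset by auto
    show ?case
    proof (rule intro[where s = "active x \<noteq> active y"
          and y = "\<lambda>b. sec (b \<noteq> active y) x \<otimes>\<^bsub>T\<^esub> sec b y"])
      fix b w assume w: "w \<in> L"
      have s: "sec (b \<noteq> active y) x \<in> carrier T" "sec b y \<in> carrier T" using eng.IH K_subset by blast+
      have "(x \<otimes>\<^bsub>T\<^esub> y) (of_bool b # w) = x (y (of_bool b # w))"
        using w by (intro tree_aut_group_mult xyT) simp
      also have "\<dots> = x (of_bool (b \<noteq> active y) # sec b y w)" using eng.IH(2) w by simp
      also have "\<dots> = of_bool ((b \<noteq> active y) \<noteq> active x) # sec (b \<noteq> active y) x (sec b y w)"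
        using eng.IH(1) tree_aut_group_carrierD(4)[OF s(2) w] by blast
      also have "\<dots> = of_bool (b \<noteq> (active x \<noteq> active y)) #
          (sec (b \<noteq> active y) x \<otimes>\<^bsub>T\<^esub> sec b y) w"
        unfolding tree_aut_group_mult[OF s w] by (cases b; cases "active x"; cases "active y") simp_all
      finally show "(x \<otimes>\<^bsub>T\<^esub> y) (of_bool b # w) = of_bool (b \<noteq> (active x \<noteq> active y)) #
          (sec (b \<noteq> active y) x \<otimes>\<^bsub>T\<^esub> sec b y) w" .
    qed (use eng.IH K.m_closed in blast)
  qed
  then show ?thesis by blast
qed

text \<open>The factor \<open>y\<close> acts first, so \<open>x\<close> meets the letter
  \<open>b \<noteq> active y\<close>.\<close>

lemma sections_mult:
  assumes xy: "x \<in> carrier K" "y \<in> carrier K"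
  shows "active (x \<otimes>\<^bsub>K\<^esub> y) \<longleftrightarrow> active x \<noteq> active y"
    "sec b (x \<otimes>\<^bsub>K\<^esub> y) = sec (b \<noteq> active y) x \<otimes>\<^bsub>K\<^esub> sec b y"
proof -
  interpret K: subgroup "carrier K" T by (rule subgroup_K)
  have xyT: "x \<in> carrier T" "y \<in> carrier T" using xy K_subset by auto
  have sT: "sec b z \<in> carrier T" if "z \<in> carrier K" for b z using sections[OF that] K_subset by blast
  have prod: "(x \<otimes>\<^bsub>T\<^esub> y) (of_bool b # w) = of_bool (b \<noteq> (active x \<noteq> active y)) #
      (sec (b \<noteq> active y) x \<otimes>\<^bsub>T\<^esub> sec b y) w" if w: "w \<in> L" for b w
  proof -
    have "(x \<otimes>\<^bsub>T\<^esub> y) (of_bool b # w) = x (y (of_bool b # w))"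
      using w by (intro tree_aut_group_mult xyT) simp
    also have "\<dots> = x (of_bool (b \<noteq> active y) # sec b y w)" using sections[OF xy(2)] w by simp
    also have "\<dots> = of_bool ((b \<noteq> active y) \<noteq> active x) # sec (b \<noteq> active y) x (sec b y w)"
      using sections[OF xy(1)] tree_aut_group_carrierD(4)[OF sT[OF xy(2)] w] by blast
    finally show ?thesis
      unfolding tree_aut_group_mult[OF sT[OF xy(1)] sT[OF xy(2)] w]
      by (cases b; cases "active x"; cases "active y") simp_all
  qed
  have ext: "sec (b \<noteq> active y) x \<otimes>\<^bsub>T\<^esub> sec b y \<in> extensional L" for b
    using sections[OF xy(1)] sections[OF xy(2)] K.m_closed K_subset tree_aut_group_carrierD(2) by blast
  show "active (x \<otimes>\<^bsub>K\<^esub> y) \<longleftrightarrow> active x \<noteq> active y"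
    unfolding K_simps(1) by (rule sections_unique(1)[OF prod ext])
  show "sec b (x \<otimes>\<^bsub>K\<^esub> y) = sec (b \<noteq> active y) x \<otimes>\<^bsub>K\<^esub> sec b y"
    unfolding K_simps(1) by (rule sections_unique(2)[OF prod ext])
qed

text \<open>Induction on the word for all elements of \<open>S\<close> simultaneously: the first
  letter is kept, and the rest is moved by a section, which lies in \<open>S\<close> again.\<close>

lemma eq_one_of_inactive_sections:
  assumes S: "S \<subseteq> carrier K" "\<And>x. x \<in> S \<Longrightarrow> \<not> active x" "\<And>x b. x \<in> S \<Longrightarrow> sec b x \<in> S"
    and x: "x \<in> S"
  shows "x = \<one>\<^bsub>K\<^esub>"
proof -
  have "y w = w" if "w \<in> L" "y \<in> S" for y w
    using that
  proof (induction w arbitrary: y rule: L_induct)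
    case Nil
    then show ?case using S(1) K_subset tree_aut_group_carrierD(1) by blast
  next
    case (Cons b w)
    have y: "y \<in> carrier K" "\<not> active y" using Cons.prems S by blast+
    have "y (of_bool b # w) = of_bool (b \<noteq> active y) # sec b y w"
      using sections[OF y(1)] Cons.hyps by blast
    also have "sec b y w = w" using Cons.IH[of "sec b y"] S(3) Cons.prems by blast
    finally show ?case using y(2) by simp
  qed
  moreover have "x \<in> extensional L" using x S(1) K_subset tree_aut_group_carrierD(2) by blast
  ultimately show ?thesis
    using x unfolding K_simps tree_aut_group_one by (intro extensionalityI[of _ L]) auto
qed

lemma mealy_group_homocyclic:
  assumes "comm_group K"
  shows "(\<exists>r<card (states A). homocyclic 0 r K) \<or> (\<exists>r\<le>card (states A). homocyclic 2 r K)"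
proof -
  interpret comm_group K by fact
  interpret self_similar_comm_group K active sec
  proof unfold_locales
    show "sec b x \<in> carrier K" if "x \<in> carrier K" for b x using sections[OF that] by blast
    show "x = \<one>\<^bsub>K\<^esub>" if "S \<subseteq> carrier K" "\<And>x. x \<in> S \<Longrightarrow> \<not> active x"
      "\<And>x b. x \<in> S \<Longrightarrow> sec b x \<in> S" "x \<in> S" for S x
      using that by (rule eq_one_of_inactive_sections)
  qed (rule sections_mult; assumption)+
  have trans: "trans_fun A q (of_bool b) \<in> states A" if "q \<in> states A" for q b
    using automaton that by (cases b) (auto simp: mealy_automaton_def binary)
  have sec_gen: "sec b (gen q) = gen (trans_fun A q (of_bool b))" for q b
    by (auto simp: sec_def restrict_def fun_eq_iff)
  show ?thesis
    by (rule homocyclic_cases[OF spans_gens, where t = "\<lambda>b q. trans_fun A q (of_bool b)"])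
      (rule trans sec_gen; assumption?)+
qed

end

lemma generated_by_mealy_homocyclic:
  assumes "comm_group G" "generated_by_mealy n {0, 1 :: nat} G"
  shows "(\<exists>r<n. homocyclic 0 r G) \<or> (\<exists>r\<le>n. homocyclic 2 r G)"
proof -
  obtain A :: "(nat, nat) mealy" where A: "mealy_automaton A" "invertible_mealy A"
    "alphabet A = {0, 1}" "card (states A) = n" "G \<cong> mealy_group A"
    using assms(2) unfolding generated_by_mealy_def by blast
  interpret binary_mealy A by unfold_locales fact+
  interpret G: comm_group G by fact
  obtain h where h: "h \<in> iso G K" using A(5) by (auto simp: is_iso_def)
  have "comm_group K"
    by (rule G.iso_imp_comm_group[OF A(5)]) (rule group.is_monoid[OF group_K])
  moreover have "K \<cong> G" by (rule G.iso_sym[OF A(5)])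
  ultimately show ?thesis
    using mealy_group_homocyclic homocyclic_iso[OF _ assms(1)] A(4) by blast
qed


section \<open>Automata realizing the groups\<close>

text \<open>An integer vector \<open>c\<close> of length \<open>r\<close> acts on words by adding \<open>c 0\<close> to the first letter modulo
  2 and continuing with the rotated vector, whose last entry is the carry if \<open>m = 0\<close>, and \<open>c 0\<close>
  otherwise. For \<open>m = 0\<close> this amounts to splitting an infinite word into \<open>r\<close> interleaved 2-adic
  integers and adding the \<open>c i\<close> to them; for \<open>m = 2\<close> the additions are letterwise.\<close>

definition rot :: "int \<Rightarrow> nat \<Rightarrow> nat \<Rightarrow> (nat \<Rightarrow> int) \<Rightarrow> nat \<Rightarrow> int" where
  "rot m r x c i = (if Suc i < r then c (Suc i)
     else if Suc i = r then (if m = 0 then (c 0 + int x) div 2 else c 0) else 0)"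

primrec act :: "int \<Rightarrow> nat \<Rightarrow> (nat \<Rightarrow> int) \<Rightarrow> nat list \<Rightarrow> nat list" where
  "act m r c [] = []"
| "act m r c (x # w) = nat ((c 0 + int x) mod 2) # act m r (rot m r x c) w"

text \<open>Padding by zeros turns equality of vectors into equality of functions, and it forces
  \<open>c 0 = 0\<close> for \<open>r = 0\<close>, where \<open>act\<close> still reads that
  entry.\<close>

definition vectors :: "nat \<Rightarrow> (nat \<Rightarrow> int) set" where
  "vectors r = {c. \<forall>i\<ge>r. c i = 0}"

lemma rot_in_vectors [simp]: "rot m r x c \<in> vectors r"
  by (simp add: vectors_def rot_def)

lemma act_in_lists [simp]: "act m r c w \<in> lists {0, 1}"
proof (induction w arbitrary: c)
  case (Cons x w)
  have "nat ((c 0 + int x) mod 2) \<in> {0, 1}"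
    using mod_pos_pos_trivial pos_mod_bound[of 2 "c 0 + int x"] pos_mod_sign[of 2 "c 0 + int x"]
    by (auto simp: nat_eq_iff)
  then show ?case using Cons by simp
qed simp

lemma carry_add:
  fixes c d x :: int
  shows "(c + (d + x) mod 2) mod 2 = (c + d + x) mod 2"
    "(c + (d + x) mod 2) div 2 + (d + x) div 2 = (c + d + x) div 2"
  by presburger+

text \<open>The second addition meets the digit \<open>?y\<close> written by the first, and by
  \<open>carry_add\<close> the two carries sum to that of the joint addition. So \<open>act\<close>
  is an action of the additive group of vectors.\<close>

lemma act_add:
  "act m r (\<lambda>i. c i + d i) w = act m r c (act m r d w)"
proof (induction w arbitrary: c d)
  case (Cons x w)
  let ?y = "nat ((d 0 + int x) mod 2)"
  have y: "int ?y = (d 0 + int x) mod 2" by simp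
  have "rot m r x (\<lambda>i. c i + d i) = (\<lambda>i. rot m r ?y c i + rot m r x d i)"
    using carry_add(2)[of "c 0" "d 0" "int x"] by (auto simp: rot_def fun_eq_iff)
  then show ?case
    using carry_add(1)[of "c 0" "d 0" "int x"] by (simp add: Cons.IH)
qed simp

lemma act_zero: "w \<in> lists {0, 1} \<Longrightarrow> act m r (\<lambda>_. 0) w = w"
proof (induction w)
  case (Cons x w)
  then have "x = 0 \<or> x = 1" by auto
  moreover from this have "rot m r x (\<lambda>_. 0) = (\<lambda>_. 0)" by (auto simp: rot_def fun_eq_iff)
  ultimately show ?case using Cons by auto
qed simp

lemma act_two_id:
  assumes "\<forall>i<r. even (c i)" "c \<in> vectors r" "w \<in> lists {0, 1}"
  shows "act 2 r c w = w"
  using assms(3,1,2)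
proof (induction w arbitrary: c)
  case (Cons x w)
  then have c0: "even (c 0)" by (cases "r = 0") (auto simp: vectors_def)
  have "x = 0 \<or> x = 1" using Cons.hyps by auto
  then have "nat ((c 0 + int x) mod 2) = x" using c0 by auto
  moreover have "act 2 r (rot 2 r x c) w = w"
  proof (rule Cons.IH)
    show "\<forall>i<r. even (rot 2 r x c i)" using Cons.prems(1) c0 by (auto simp: rot_def)
  qed simp
  ultimately show ?case by simp
qed simp

section \<open>Kernel of the action on words\<close>

lemma even_of_act_id:
  assumes "\<And>w. w \<in> lists {0, 1} \<Longrightarrow> act m r c w = w"
  shows "even (c 0)" "x \<in> {0, 1} \<Longrightarrow> w \<in> lists {0, 1} \<Longrightarrow> act m r (rot m r x c) w = w"
proof -
  have "act m r c [0] = [0]" by (rule assms) simp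
  then have "c 0 mod 2 \<le> 0" by simp
  then show "even (c 0)" using pos_mod_sign[of 2 "c 0"] by presburger
  show "act m r (rot m r x c) w = w" if "x \<in> {0, 1}" "w \<in> lists {0, 1}"
    using assms[of "x # w"] that by simp
qed

text \<open>After \<open>i\<close> rotations entry \<open>i\<close> is in front, not yet altered by
  a carry, and its parity is visible in the next digit.\<close>

lemma even_of_act_id_all:
  assumes "\<And>w. w \<in> lists {0, 1} \<Longrightarrow> act m r c w = w" "i < r"
  shows "even (c i)"
  using assms
proof (induction i arbitrary: c)
  case 0
  then show ?case using even_of_act_id(1) by blast
next
  case (Suc i)
  have "even (rot m r 0 c i)"
    using Suc.prems by (intro Suc.IH even_of_act_id(2)) auto
  then show ?case using Suc.prems(2) by (simp add: rot_def)
qed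

lemma act_zero_halve:
  assumes "\<And>w. w \<in> lists {0, 1} \<Longrightarrow> act 0 r c w = w" "c \<in> vectors r" "w \<in> lists {0, 1}"
  shows "act 0 r (\<lambda>i. c i div 2) w = w"
proof -
  \<comment> \<open>\<open>s k\<close> is the vector left after reading \<open>k\<close> zeros. A
    full turn of \<open>r\<close> zeros brings each entry back to its place, halved.\<close>
  define s where "s k i = (if i + k < r then c (i + k) else if i < r then c (i + k - r) div 2 else 0)"
    for k i
  have even: "even (c i)" if "i < r" for i using even_of_act_id_all[OF assms(1) that] .
  have "act 0 r (s k) w = w" if "k \<le> r" "w \<in> lists {0, 1}" for k w
    using that
  proof (induction k arbitrary: w)
    case 0
    have "s 0 = c" using assms(2) by (auto simp: s_def vectors_def fun_eq_iff)
    then show ?case using assms(1) 0 by simp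
  next
    case (Suc k)
    have "act 0 r (rot 0 r 0 (s k)) w = w"
      using Suc by (intro even_of_act_id(2)) auto
    moreover have "rot 0 r 0 (s k) = s (Suc k)"
    proof
      fix i
      consider "Suc i < r" | "Suc i = r" | "r \<le> i" by linarith
      then show "rot 0 r 0 (s k) i = s (Suc k) i"
        using Suc.prems(1) by cases (auto simp: rot_def s_def)
    qed
    ultimately show ?case by simp
  qed
  then have "act 0 r (s r) w = w" using assms(3) by simp
  moreover have "s r = (\<lambda>i. c i div 2)" using assms(2) by (auto simp: s_def vectors_def fun_eq_iff)
  ultimately show ?thesis by simp
qed

text \<open>Descent: the entries are even, and the halved vector acts trivially as well. In 2-adic
  terms, only 0 is divisible by every power of 2.\<close>

lemma zero_of_act_id:
  assumes "\<And>w. w \<in> lists {0, 1} \<Longrightarrow> act 0 r c w = w" "c \<in> vectors r"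
  shows "c i = 0"
  using assms
proof (induction "nat \<bar>c i\<bar>" arbitrary: c rule: less_induct)
  case less
  show ?case
  proof (rule ccontr)
    assume nz: "c i \<noteq> 0"
    then have "i < r" using less.prems(2) by (auto simp: vectors_def not_less[symmetric])
    then have ev: "even (c i)" using even_of_act_id_all less.prems(1) by blast
    have "c i div 2 = 0"
    proof (rule less.hyps)
      show "nat \<bar>c i div 2\<bar> < nat \<bar>c i\<bar>" using nz ev by (auto elim!: evenE)
      show "(\<lambda>i. c i div 2) \<in> vectors r" using less.prems(2) by (simp add: vectors_def)
    qed (rule act_zero_halve[OF less.prems])
    then show False using nz ev by (auto elim!: evenE)
  qed
qed

text \<open>The kernel, in the form required by the relations in \<open>homocyclic\<close>.\<close>

lemma act_id_iff:
  assumes "m \<in> {0, 2}" "c \<in> vectors r"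
  shows "(\<forall>w\<in>lists {0, 1}. act m r c w = w) \<longleftrightarrow> (\<forall>i<r. m dvd c i)"
proof
  assume id: "\<forall>w\<in>lists {0, 1}. act m r c w = w"
  show "\<forall>i<r. m dvd c i"
  proof (cases "m = 0")
    case True
    then show ?thesis using zero_of_act_id[of r c] id assms(2) by auto
  next
    case False
    then show ?thesis using even_of_act_id_all[of m r c] id assms(1) by auto
  qed
next
  assume dvd: "\<forall>i<r. m dvd c i"
  show "\<forall>w\<in>lists {0, 1}. act m r c w = w"
  proof (cases "m = 0")
    case True
    then have "c i = 0" for i
      using dvd assms(2) by (cases "i < r") (auto simp: vectors_def)
    then have "c = (\<lambda>_. 0)" by auto
    then show ?thesis using act_zero by blast
  next
    case False
    then show ?thesis using act_two_id[of r c] dvd assms by auto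
  qed
qed

section \<open>Automata whose states are unit vectors, padded by trivial states\<close>

definition unit_vec :: "nat \<Rightarrow> nat \<Rightarrow> nat \<Rightarrow> int" where
  "unit_vec r i j = (if i < r \<and> j = i then 1 else 0)"

text \<open>States from \<open>r\<close> on stand for the zero vector and never move. For
  \<open>m = 0\<close> state 0 goes to the trivial state \<open>r\<close> when the digit 0 produces
  no carry, so \<open>r < n\<close> has to hold; for \<open>m = 2\<close> the unit is passed on
  regardless of the digit.\<close>

definition shift_state :: "int \<Rightarrow> nat \<Rightarrow> nat \<Rightarrow> nat \<Rightarrow> nat" where
  "shift_state m r i x = (if i = 0 \<and> 0 < r then (if m = 0 \<and> x = 0 then r else r - 1)
     else if i < r then i - 1 else i)"

definition shift_automaton :: "int \<Rightarrow> nat \<Rightarrow> nat \<Rightarrow> (nat, nat) mealy" where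
  "shift_automaton m r n = \<lparr>alphabet = {0, 1}, states = {..<n},
     trans_fun = shift_state m r, out_fun = (\<lambda>i x. if i = 0 \<and> 0 < r then 1 - x else x)\<rparr>"

lemma rot_unit_vec:
  "x \<in> {0, 1} \<Longrightarrow> rot m r x (unit_vec r i) = unit_vec r (shift_state m r i x)"
  by (auto simp: rot_def unit_vec_def shift_state_def fun_eq_iff)

lemma state_map_shift_automaton:
  "w \<in> lists {0, 1} \<Longrightarrow> state_map (shift_automaton m r n) i w = act m r (unit_vec r i) w"
proof (induction w arbitrary: i)
  case (Cons x w)
  then have x: "x \<in> {0, 1}" by simp
  moreover have "out_fun (shift_automaton m r n) i x = nat ((unit_vec r i 0 + int x) mod 2)"
    using x by (auto simp: shift_automaton_def unit_vec_def)
  moreover have "trans_fun (shift_automaton m r n) i x = shift_state m r i x"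
    by (simp add: shift_automaton_def)
  ultimately show ?case
    using Cons.IH Cons.prems by (simp add: rot_unit_vec)
qed simp

lemma shift_automaton_mealy:
  assumes "if m = 0 then r < n else r \<le> n"
  shows "mealy_automaton (shift_automaton m r n)" "invertible_mealy (shift_automaton m r n)"
proof -
  show "mealy_automaton (shift_automaton m r n)"
    using assms by (auto simp: mealy_automaton_def shift_automaton_def shift_state_def split: if_splits)
  have "bij_betw (\<lambda>x. 1 - x) {0, 1} {0, 1 :: nat}" by (auto simp: bij_betw_def)
  moreover have "bij_betw (\<lambda>x. x) {0, 1} {0, 1 :: nat}" by (auto simp: bij_betw_def)
  ultimately have "bij_betw (\<lambda>x. if i = 0 \<and> 0 < r then 1 - x else x) {0, 1} {0, 1 :: nat}" for i :: nat
    by (cases "i = 0 \<and> 0 < r") (simp_all only: if_True if_False simp_thms)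
  then show "invertible_mealy (shift_automaton m r n)"
    by (simp add: invertible_mealy_def shift_automaton_def)
qed

lemma homocyclic_shift_automaton:
  assumes m: "m \<in> {0, 2}" and rn: "if m = 0 then r < n else r \<le> n"
  shows "homocyclic m r (mealy_group (shift_automaton m r n))"
proof -
  let ?A = "shift_automaton m r n"
  interpret binary_mealy ?A
    by unfold_locales (use shift_automaton_mealy[OF rn] in \<open>auto simp: shift_automaton_def\<close>)
  have states: "states ?A = {..<n}" by (simp add: shift_automaton_def)
  define \<Phi> where "\<Phi> c = restrict (act m r c) L" for c
  have gen: "gen i = \<Phi> (unit_vec r i)" for i
    unfolding \<Phi>_def by (rule restrict_ext) (rule state_map_shift_automaton)
  interpret T: group T by (rule group_tree_aut_group)
  interpret K: subgroup "carrier K" T by (rule subgroup_K)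
  have \<Phi>_zero: "\<Phi> (\<lambda>_. 0) = \<one>\<^bsub>T\<^esub>"
    unfolding \<Phi>_def tree_aut_group_one by (rule restrict_ext) (rule act_zero)
  \<comment> \<open>Membership of \<open>\<Phi> c\<close> in \<open>T\<close> is a premise here; it
    is inherited from the generators along products and inverses instead of being shown for
    arbitrary \<open>c\<close>.\<close>
  have \<Phi>_add: "\<Phi> c \<otimes>\<^bsub>T\<^esub> \<Phi> d = \<Phi> (\<lambda>i. c i + d i)"
    if "\<Phi> c \<in> carrier T" "\<Phi> d \<in> carrier T" for c d
  proof (rule extensionalityI[of _ L])
    show "\<Phi> c \<otimes>\<^bsub>T\<^esub> \<Phi> d \<in> extensional L" using that tree_aut_group_carrierD(2) by blast
    show "(\<Phi> c \<otimes>\<^bsub>T\<^esub> \<Phi> d) w = \<Phi> (\<lambda>i. c i + d i) w" if w: "w \<in> L" for w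
      using w tree_aut_group_mult[OF \<open>\<Phi> c \<in> carrier T\<close> \<open>\<Phi> d \<in> carrier T\<close> w]
      by (simp only: \<Phi>_def restrict_apply act_in_lists if_True act_add)
  qed (simp add: \<Phi>_def)
  have \<Phi>_neg: "\<Phi> (\<lambda>i. - c i) \<in> carrier T \<and> inv\<^bsub>T\<^esub> \<Phi> c = \<Phi> (\<lambda>i. - c i)" if c: "\<Phi> c \<in> carrier T" for c
  proof -
    have "inv\<^bsub>T\<^esub> \<Phi> c = \<Phi> (\<lambda>i. - c i)"
    proof (rule extensionalityI[of _ L])
      show "inv\<^bsub>T\<^esub> \<Phi> c \<in> extensional L" using T.inv_closed[OF c] tree_aut_group_carrierD(2) by blast
      fix w assume w: "w \<in> L"
      have v: "(inv\<^bsub>T\<^esub> \<Phi> c) w \<in> L" using tree_aut_group_carrierD(4)[OF T.inv_closed[OF c] w] .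
      have "\<Phi> c ((inv\<^bsub>T\<^esub> \<Phi> c) w) = (\<Phi> c \<otimes>\<^bsub>T\<^esub> inv\<^bsub>T\<^esub> \<Phi> c) w"
        by (rule tree_aut_group_mult[OF c T.inv_closed[OF c] w, symmetric])
      then have "act m r c ((inv\<^bsub>T\<^esub> \<Phi> c) w) = w"
        using T.r_inv[OF c] w v by (simp add: tree_aut_group_one \<Phi>_def)
      \<comment> \<open>Here \<open>w\<close> is rewritten as the image under \<open>c\<close> of
        its preimage, so that \<open>- c\<close> and \<open>c\<close> cancel.\<close>
      then have "act m r (\<lambda>i. - c i) w = act m r (\<lambda>i. - c i + c i) ((inv\<^bsub>T\<^esub> \<Phi> c) w)"
        by (simp only: act_add)
      also have "\<dots> = (inv\<^bsub>T\<^esub> \<Phi> c) w" using act_zero[OF v] by simp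
      finally show "(inv\<^bsub>T\<^esub> \<Phi> c) w = \<Phi> (\<lambda>i. - c i) w" using w by (simp add: \<Phi>_def)
    qed (simp add: \<Phi>_def)
    then show ?thesis using T.inv_closed[OF c] by simp
  qed
  have K_vec: "\<exists>c. x = \<Phi> c" if "x \<in> carrier K" for x
  proof -
    from that have "x \<in> generate T (gen ` states ?A)" by (simp add: K_simps)
    then have "x \<in> carrier T \<and> (\<exists>c. x = \<Phi> c)"
    proof induction
      case one
      then show ?case using \<Phi>_zero by (metis T.one_closed)
    next
      case (incl h)
      then show ?case using gens_subset gen by blast
    next
      case (inv h)
      then obtain c where "h = \<Phi> c" "h \<in> carrier T" using gens_subset gen by blast
      then show ?case using \<Phi>_neg T.inv_closed by blast
    next
      case (eng x y)
      then obtain c d where cd: "x = \<Phi> c" "y = \<Phi> d" "\<Phi> c \<in> carrier T" "\<Phi> d \<in> carrier T"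
        by blast
      have "x \<otimes>\<^bsub>T\<^esub> y = \<Phi> (\<lambda>i. c i + d i)" unfolding cd(1,2) by (rule \<Phi>_add[OF cd(3,4)])
      moreover have "x \<otimes>\<^bsub>T\<^esub> y \<in> carrier T" using cd by simp
      ultimately show ?case by blast
    qed
    then show ?thesis ..
  qed
  have "comm_group K"
  proof (rule group.group_comm_groupI[OF group_K])
    fix x y assume xy: "x \<in> carrier K" "y \<in> carrier K"
    obtain c d where cd: "x = \<Phi> c" "y = \<Phi> d" using K_vec xy by blast
    have "\<Phi> c \<in> carrier T" "\<Phi> d \<in> carrier T" using xy cd K_subset by auto
    then show "x \<otimes>\<^bsub>K\<^esub> y = y \<otimes>\<^bsub>K\<^esub> x"
      unfolding K_simps cd by (simp add: \<Phi>_add add.commute)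
  qed
  then interpret KG: comm_group K .
  define f where "f i = \<Phi> (unit_vec r i)" for i
  have rn': "r \<le> n" using rn by (auto split: if_splits)
  have f: "f ` {..<r} \<subseteq> carrier K"
    using rn' by (auto simp: f_def gen[symmetric] K_simps states intro!: generate.incl)
  have int_pow: "f i [^]\<^bsub>K\<^esub> k = \<Phi> (\<lambda>j. k * unit_vec r i j)" if "i < r" for i and k :: int
  proof (induction k rule: int_induct[of _ 0])
    case base
    then show ?case using \<Phi>_zero by (simp add: K_simps)
  next
    case (step1 k)
    have fi: "f i \<in> carrier K" using f that by auto
    have "f i [^]\<^bsub>K\<^esub> (k + 1) = f i [^]\<^bsub>K\<^esub> k \<otimes>\<^bsub>K\<^esub> f i"
      using KG.int_pow_mult[OF fi, of k 1] fi by simp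
    also have "\<dots> = \<Phi> (\<lambda>j. k * unit_vec r i j) \<otimes>\<^bsub>T\<^esub> \<Phi> (unit_vec r i)"
      by (simp only: step1 K_simps(1)) (simp only: f_def)
    also have "\<dots> = \<Phi> (\<lambda>j. k * unit_vec r i j + unit_vec r i j)"
      using fi KG.int_pow_closed[OF fi, of k] K_subset
      by (intro \<Phi>_add) (auto simp: step1(2)[symmetric] f_def[symmetric])
    finally show ?case by (simp add: algebra_simps)
  next
    case (step2 k)
    have fi: "f i \<in> carrier K" using f that by auto
    have fT: "\<Phi> (unit_vec r i) \<in> carrier T" using fi K_subset by (auto simp: f_def)
    have inv: "f i [^]\<^bsub>K\<^esub> (- 1 :: int) = \<Phi> (\<lambda>j. - unit_vec r i j)"
    proof -
      have "\<Phi> (\<lambda>j. - unit_vec r i j) \<in> carrier K"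
        using \<Phi>_neg[OF fT] K.m_inv_closed[OF fi] by (simp add: f_def)
      moreover have "\<Phi> (\<lambda>j. - unit_vec r i j) \<otimes>\<^bsub>K\<^esub> f i = \<one>\<^bsub>K\<^esub>"
        using \<Phi>_add[of "\<lambda>j. - unit_vec r i j" "unit_vec r i"] \<Phi>_neg[OF fT] fT \<Phi>_zero
        by (simp add: K_simps f_def)
      ultimately show ?thesis
        using KG.inv_equality[OF _ fi] KG.int_pow_neg[OF fi, of 1] fi by simp
    qed
    have "f i [^]\<^bsub>K\<^esub> (k - 1) = f i [^]\<^bsub>K\<^esub> k \<otimes>\<^bsub>K\<^esub> f i [^]\<^bsub>K\<^esub> (- 1 :: int)"
      using KG.int_pow_mult[OF fi, of k "- 1"] by simp
    also have "\<dots> = \<Phi> (\<lambda>j. k * unit_vec r i j) \<otimes>\<^bsub>T\<^esub> \<Phi> (\<lambda>j. - unit_vec r i j)"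
      by (simp only: step2 inv K_simps(1))
    also have "\<dots> = \<Phi> (\<lambda>j. k * unit_vec r i j + - unit_vec r i j)"
      using KG.int_pow_closed[OF fi, of k] K_subset \<Phi>_neg[OF fT]
      by (intro \<Phi>_add) (auto simp: step2(2)[symmetric])
    finally show ?case by (simp add: algebra_simps)
  qed
  have comb: "int_comb K J f c = \<Phi> (\<lambda>i. if i \<in> J then c i else 0)"
    if "finite J" "J \<subseteq> {..<r}" for J c
    using that
  proof (induction J)
    case empty
    then show ?case using \<Phi>_zero by (simp add: int_comb_def K_simps)
  next
    case (insert i J)
    have fj: "f j \<in> carrier K" if "j \<in> insert i J" for j using f insert.prems that by auto
    have "int_comb K (insert i J) f c = f i [^]\<^bsub>K\<^esub> c i \<otimes>\<^bsub>K\<^esub> int_comb K J f c"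
      unfolding int_comb_def using fj insert.hyps by (intro KG.finprod_insert) simp_all
    also have "\<dots> = \<Phi> (\<lambda>j. c i * unit_vec r i j) \<otimes>\<^bsub>T\<^esub> \<Phi> (\<lambda>j. if j \<in> J then c j else 0)"
      using insert int_pow by (simp add: K_simps(1))
    also have "\<dots> = \<Phi> (\<lambda>j. c i * unit_vec r i j + (if j \<in> J then c j else 0))"
    proof (rule \<Phi>_add)
      show "\<Phi> (\<lambda>j. c i * unit_vec r i j) \<in> carrier T"
        using KG.int_pow_closed[OF fj, of i "c i"] int_pow[of i "c i"] insert.prems K_subset by auto
      have "int_comb K J f c \<in> carrier K" using fj by (intro KG.int_comb_closed) auto
      then show "\<Phi> (\<lambda>j. if j \<in> J then c j else 0) \<in> carrier T"
        using insert K_subset by auto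
    qed
    also have "(\<lambda>j. c i * unit_vec r i j + (if j \<in> J then c j else 0))
        = (\<lambda>j. if j \<in> insert i J then c j else 0)"
      using insert by (auto simp: unit_vec_def fun_eq_iff)
    finally show ?case .
  qed
  \<comment> \<open>The states from \<open>r\<close> on act as the identity, so the first
    \<open>r\<close> states generate already.\<close>
  have "spans K {..<r} f"
  proof (rule KG.spans_change)
    show "spans K (states ?A) gen" by (rule spans_gens)
    show "gen ` states ?A \<subseteq> generate K (f ` {..<r})"
    proof
      fix x assume "x \<in> gen ` states ?A"
      then obtain i where i: "x = gen i" by blast
      show "x \<in> generate K (f ` {..<r})"
      proof (cases "i < r")
        case True
        then show ?thesis unfolding i gen f_def[symmetric] by (intro generate.incl) simp
      next
        case False
        then have "unit_vec r i = (\<lambda>_. 0)" by (auto simp: unit_vec_def)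
        then have "x = \<one>\<^bsub>K\<^esub>" using i gen \<Phi>_zero by (simp add: K_simps)
        then show ?thesis by (simp add: generate.one)
      qed
    qed
  qed (use f in simp_all)
  moreover have "int_comb K {..<r} f c = \<one>\<^bsub>K\<^esub> \<longleftrightarrow> (\<forall>i<r. m dvd c i)" for c
  proof -
    \<comment> \<open>The coefficients are cut off at \<open>r\<close>, because
      \<open>act_id_iff\<close> speaks about elements of \<open>vectors r\<close>.\<close>
    let ?c = "\<lambda>i. if i < r then c i else 0"
    have "int_comb K {..<r} f c = \<one>\<^bsub>K\<^esub> \<longleftrightarrow> \<Phi> ?c = (\<lambda>w\<in>L. w)"
      using comb[of "{..<r}" c] by (simp add: K_simps tree_aut_group_one)
    also have "\<dots> \<longleftrightarrow> (\<forall>w\<in>L. act m r ?c w = w)"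
      unfolding \<Phi>_def by (auto simp: restrict_def fun_eq_iff)
    also have "\<dots> \<longleftrightarrow> (\<forall>i<r. m dvd ?c i)"
      by (rule act_id_iff[OF m]) (simp add: vectors_def)
    finally show ?thesis by simp
  qed
  ultimately show ?thesis unfolding homocyclic_def using KG.comm_group_axioms by blast
qed

lemma MA_eq: "MA n = {G. (\<exists>r<n. homocyclic 0 r G) \<or> (\<exists>r\<le>n. homocyclic 2 r G)}"
proof (intro equalityI subsetI)
  fix G :: "('a, 'b) monoid_scheme"
  assume "G \<in> MA n"
  then show "G \<in> {G. (\<exists>r<n. homocyclic 0 r G) \<or> (\<exists>r\<le>n. homocyclic 2 r G)}"
    using generated_by_mealy_homocyclic by (auto simp: MA_def)
next
  fix G :: "('a, 'b) monoid_scheme"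
  assume "G \<in> {G. (\<exists>r<n. homocyclic 0 r G) \<or> (\<exists>r\<le>n. homocyclic 2 r G)}"
  then obtain m :: int and r where m: "m \<in> {0, 2}" "if m = 0 then r < n else r \<le> n"
    and G: "homocyclic m r G" by force
  have "G \<cong> mealy_group (shift_automaton m r n)"
    by (rule homocyclic_unique[OF G homocyclic_shift_automaton[OF m]])
  then have "generated_by_mealy n {0, 1 :: nat} G"
    unfolding generated_by_mealy_def using shift_automaton_mealy[OF m(2)]
    by (intro exI[of _ "shift_automaton m r n"]) (simp add: shift_automaton_def)
  then show "G \<in> MA n" using homocyclic_imp_comm_group[OF G] by (simp add: MA_def)
qed

section \<open>Counting isomorphism types\<close>

lemma homocyclic_countable:
  assumes "homocyclic m r G"
  shows "countable (carrier G)"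
proof -
  obtain f where G: "comm_group G" and f: "spans G {..<r} f"
    using assms unfolding homocyclic_def by blast
  interpret comm_group G by fact
  have "carrier G \<subseteq> (\<lambda>l. int_comb G {..<r} f (\<lambda>i. l ! i)) ` (UNIV :: int list set)"
  proof
    fix x assume "x \<in> carrier G"
    then obtain c where "x = int_comb G {..<r} f c" by (rule spans_obtain[OF f])
    also have "\<dots> = int_comb G {..<r} f (\<lambda>i. map c [0..<r] ! i)"
      by (rule int_comb_cong) (use spansD(2)[OF f] in auto)
    finally show "x \<in> (\<lambda>l. int_comb G {..<r} f (\<lambda>i. l ! i)) ` UNIV" by blast
  qed
  then show ?thesis by (rule countable_subset) simp
qed

text \<open>The group of a realizing automaton is countable, so its structure can be transported
  along an injection into the infinite type. \<open>Suc r\<close> states suffice for both values of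
  \<open>m\<close>.\<close>

lemma homocyclic_exists:
  assumes "infinite (UNIV :: 'a set)" "m \<in> {0, 2}"
  shows "\<exists>G :: ('a, 'b) monoid_scheme. homocyclic m r G"
proof -
  define H where "H = mealy_group (shift_automaton m r (Suc r))"
  have H: "homocyclic m r H"
    unfolding H_def by (rule homocyclic_shift_automaton[OF assms(2)]) simp
  interpret H: comm_group H by (rule homocyclic_imp_comm_group[OF H])
  obtain h :: "nat \<Rightarrow> 'a" where h: "inj h"
    using infinite_countable_subset[OF assms(1)] by blast
  define g where "g = h \<circ> to_nat_on (carrier H)"
  have g: "inj_on g (carrier H)"
    unfolding g_def using inj_on_to_nat_on[OF homocyclic_countable[OF H]] h
    by (intro comp_inj_on) (auto intro: inj_on_subset)
  define k where "k = inv_into (carrier H) g"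
  have k: "k (g x) = x" if "x \<in> carrier H" for x unfolding k_def using g that by simp
  define G :: "('a, 'b) monoid_scheme" where
    \<comment> \<open>The extension field of the record carries no group structure and may have any
      value.\<close>
    "G = \<lparr>carrier = g ` carrier H, monoid.mult = (\<lambda>x y. g (k x \<otimes>\<^bsub>H\<^esub> k y)),
          one = g \<one>\<^bsub>H\<^esub>, \<dots> = undefined\<rparr>"
  have iso: "g \<in> iso H G"
    unfolding iso_iff using g by (auto simp: G_def k intro!: homI)
  have "monoid G"
    by (rule monoidI) (auto simp: G_def k H.m_assoc)
  then have "comm_group G"
    by (intro H.iso_imp_comm_group[OF is_isoI[OF iso]])
  then show ?thesis using homocyclic_iso[OF H] is_isoI[OF iso] by blast
qed

lemma card_iso_classes:
  assumes "infinite (UNIV :: 'a set)" "n \<ge> 1"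
  shows "card ((MA n :: ('a, 'b) monoid_scheme set) // iso_rel (MA n)) = 2 * n"
proof -
  let ?M = "MA n :: ('a, 'b) monoid_scheme set"
  \<comment> \<open>The index set lists every type once: the trivial group appears as the free group
    of rank 0, so the ranks for \<open>2\<close> start at 1. This leaves \<open>n\<close> indices of
    each kind.\<close>
  define I where "I = {0 :: int} \<times> {..<n} \<union> {2} \<times> {1..n}"
  define C where "C = (\<lambda>(m, r). {G :: ('a, 'b) monoid_scheme. homocyclic m r G})"
  have triv: "homocyclic 2 0 G \<Longrightarrow> homocyclic 0 0 G" for G :: "('a, 'b) monoid_scheme"
    by (simp add: homocyclic_def)
  have M: "?M = (\<Union>p\<in>I. C p)"
  proof (intro equalityI subsetI)
    fix G assume "G \<in> ?M"
    then consider r where "r < n" "homocyclic 0 r G" | r where "r \<le> n" "homocyclic 2 r G"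
      unfolding MA_eq by blast
    then show "G \<in> (\<Union>p\<in>I. C p)"
    proof cases
      case (1 r)
      then show ?thesis by (intro UN_I[of "(0, r)"]) (auto simp: I_def C_def)
    next
      case (2 r)
      show ?thesis
      proof (cases "r = 0")
        case True
        with 2 triv assms(2) show ?thesis by (intro UN_I[of "(0, 0)"]) (auto simp: I_def C_def)
      next
        case False
        with 2 show ?thesis by (intro UN_I[of "(2, r)"]) (auto simp: I_def C_def)
      qed
    qed
  qed (auto simp: MA_eq I_def C_def)
  have disj: "p = q" if "p \<in> I" "q \<in> I" "G \<in> C p" "G \<in> C q" for p q G
  proof -
    obtain m r m' s where pq: "p = (m, r)" "q = (m', s)" by (cases p, cases q)
    have h: "homocyclic m r G" "homocyclic m' s G" using that(3,4) pq by (simp_all add: C_def)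
    \<comment> \<open>Evenness makes \<open>homocyclic_rank_le\<close> available in both directions.
      Then \<open>m = m'\<close>, since by \<open>homocyclic_zero_two\<close> a group of both kinds
      would have rank 0 for the value 2, which \<open>I\<close> omits.\<close>
    have "even m" "even m'" using that(1,2) pq by (auto simp: I_def)
    then have "r = s"
      using homocyclic_rank_le[OF h] homocyclic_rank_le[OF h(2,1)] by simp
    moreover have "m = m'"
      using that(1,2) pq h homocyclic_zero_two by (fastforce simp: I_def)
    ultimately show ?thesis using pq by simp
  qed
  have iso_class: "iso_rel ?M `` {G} = C p" if "p \<in> I" "G \<in> C p" for p G
  proof -
    obtain m r where p: "p = (m, r)" by (cases p)
    have G: "homocyclic m r G" using that(2) p by (simp add: C_def)
    have "G \<in> ?M" using that M by blast
    have "C p \<subseteq> ?M" using that M by blast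
    moreover have "G \<cong> H \<longleftrightarrow> H \<in> C p" if "H \<in> ?M" for H
      using that homocyclic_unique[OF G] homocyclic_iso[OF G]
      by (auto simp: p C_def MA_def)
    ultimately show ?thesis using \<open>G \<in> ?M\<close> by (auto simp: iso_rel_def)
  qed
  have ex: "\<exists>G. G \<in> C p" if "p \<in> I" for p
    using homocyclic_exists[OF assms(1)] that by (auto simp: I_def C_def)
  have "?M // iso_rel ?M = C ` I"
  proof (intro equalityI subsetI)
    fix Y assume "Y \<in> ?M // iso_rel ?M"
    then obtain G where "G \<in> ?M" "Y = iso_rel ?M `` {G}" by (rule quotientE)
    then show "Y \<in> C ` I" using M iso_class by blast
  next
    fix Y assume "Y \<in> C ` I"
    then obtain p G where "p \<in> I" "Y = C p" "G \<in> C p" using ex by blast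
    then show "Y \<in> ?M // iso_rel ?M" using M iso_class by (metis UN_I quotientI)
  qed
  moreover have "inj_on C I"
    using ex disj by (metis inj_onI)
  moreover have "card I = 2 * n"
    unfolding I_def by (subst card_Un_disjoint) auto
  ultimately show ?thesis by (simp add: card_image)
qed

theorem theorem2:
  fixes n :: nat
  assumes "n \<ge> 1"
  shows "(MA n :: ('a, 'b) monoid_scheme set) = FA (n - 1) \<union> EA2 n \<and>
         (infinite (UNIV :: 'a set) \<longrightarrow>
            card ((MA n :: ('a, 'b) monoid_scheme set) // iso_rel (MA n)) = 2 * n)"
proof (intro conjI impI)
  have "r < n \<longleftrightarrow> r \<le> n - 1" for r using assms by auto
  then show "(MA n :: ('a, 'b) monoid_scheme set) = FA (n - 1) \<union> EA2 n"
    unfolding MA_eq FA_eq EA2_eq by auto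
qed (rule card_iso_classes[OF _ assms])

end
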